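(* For all $n\ge1$ and $t\ge0$ one has the equalities of positive kernels $P^{n+1}_t\Lambda_{n,n+1}=\Lambda_{n,n+1}\hat P^n_t$ (as kernels from $W^{n+1}$ to $W^n$) and $\hat P^n_t\Lambda_{n,n}=\Lambda_{n,n}P^n_t$ (as kernels from $W^n$ to $W^n$). Explicitly, for $x\in W^{n+1}$, $y'\in W^n$: $$\sum_{x'\in W^{n+1}}\det(p_t(x_i,x'_j))_{i,j=1}^{n+1}\prod_{i=1}^n\hat\pi(y'_i)\mathbf 1(y'\in W^{n,n+1}(x'))=\sum_{y\in W^{n,n+1}(x)}\prod_{i=1}^n\hat\pi(y_i)\det(\hat p_t(y_i,y'_j))_{i,j=1}^n,$$ and for $x,y'\in W^n$: $$\sum_{x'\in W^{n}}\det(\hat p_t(x_i,x'_j))_{i,j=1}^{n}\prod_{i=1}^n\pi(y'_i)\mathbf 1(y'\in W^{n,n}(x'))=\sum_{y\in W^{n,n}(x)}\prod_{i=1}^n\pi(y_i)\det(p_t(y_i,y'_j))_{i,j=1}^n.$$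
   Context: Let $I=\mathbb N=\{0,1,2,\dots\}$ (with $l=0$) or $I=\mathbb Z$ (with $l=-\infty$). Let $\lambda,\mu:I\to[0,\infty)$ with $\lambda(x)>0$ and $\mu(x)>0$ for all $x\in I$, except that $\mu(0)=0$ when $I=\mathbb N$. Put $\pi(0)=1$, $\pi(x)=\prod_{i=1}^{x}\lambda(i-1)/\mu(i)$ for $x\ge1$ and $\pi(x)=\prod_{i=1}^{-x}\mu(x+i)/\lambda(x+i-1)$ for $x\le-1$. Assume $\pm\infty$ are natural boundaries: if $I=\mathbb N$, $\sum_{j\ge0}\frac{1}{\lambda(j)\pi(j)}\sum_{i=0}^{j}\pi(i)=\infty$ and $\sum_{j\ge0}\frac{1}{\lambda(j)\pi(j)}\sum_{i>j}\pi(i)=\infty$; if $I=\mathbb Z$, $\sum_{j\ge1}\frac{1}{\lambda(j)\pi(j)}\sum_{i=1}^{j}\pi(i)=\infty$, $\sum_{j\ge1}\pi(j)\sum_{i=1}^{j-1}\frac{1}{\lambda(i)\pi(i)}=\infty$, $\sum_{j\le-1}\frac{1}{\lambda(j)\pi(j)}\sum_{i=j+1}^{-1}\pi(i)=\infty$, $\sum_{j\le -1}\pi(j)\sum_{i=j}^{-1}\frac{1}{\lambda(i)\pi(i)}=\infty$. The $\mathcal D$-chain is the continuous-time Markov chain on $I$ jumping $x\to x+1$ at rate $\lambda(x)$ and $x\to x-1$ at rate $\mu(x)$; $p_t(x,y)$ denotes its transition probabilities. Its Siegmund dual, the $\hat{\mathcal D}$-chain, has rates $\hat\lambda(x)=\mu(x+1)$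 (for $x\to x+1$) and $\hat\mu(x)=\lambda(x)$ (for $x\to x-1$); when $I=\mathbb N$ it lives on $\{-1,0,1,\dots\}$ and is absorbed at $-1$. $\hat p_t(x,y)$, $x,y\in I$, denotes its transition probabilities restricted to $I$ (equivalently, those of the chain killed at $-1$). $\hat\pi(0)=1$, $\hat\pi(x)=\prod_{i=1}^x\mu(i)/\lambda(i)$ for $x\ge1$, $\hat\pi(x)=\prod_{i=1}^{-x}\lambda(x+i)/\mu(x+i)$ for $x\le-1$. $W^n=\{x\in I^n:x_1<\dots<x_n\}$. For $x\in W^{n+1}$, $W^{n,n+1}(x)=\{y\in W^n:x_1\le y_1<x_2\le y_2<\dots\le y_n<x_{n+1}\}$; for $x\in W^n$, $W^{n,n}(x)=\{y\in W^n:y_1\le x_1<y_2\le x_2<\dots<y_n\le x_n\}$. Karlin–McGregor kernels: $P^n_t(x,y)=\det(p_t(x_i,y_j))_{i,j=1}^n$ and $\hat P^n_t(x,y)=\det(\hat p_t(x_i,y_j))_{i,j=1}^n$ on $W^n$. $\Lambda_{n,n+1}(x,y)=\prod_{i=1}^n\hat\pi(y_i)\mathbf 1(y\in W^{n,n+1}(x))$ for $x\in W^{n+1},y\in W^n$; $\Lambda_{n,n}(x,y)=\prod_{i=1}^n\pi(y_i)\mathbf 1(y\in W^{n,n}(x))$ for $x,y\in W^n$. *)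

theory Defs
  imports "HOL-Analysis.Analysis" "Jordan_Normal_Form.Determinant"
begin

text \<open>Birth--death chain on a state space S (a subset of int) with upward rates up
  and downward rates dn; jumps leaving S kill the chain.  mtp_k S up dn k t x y is the
  probability to be at y at time t having made at most k jumps (Feller's backward
  iteration); the minimal transition function is its supremum over k.\<close>

primrec mtp_k :: "int set \<Rightarrow> (int \<Rightarrow> real) \<Rightarrow> (int \<Rightarrow> real) \<Rightarrow> nat \<Rightarrow> real \<Rightarrow> int \<Rightarrow> int \<Rightarrow> real" where
  "mtp_k S up dn 0 t x y = (if x = y then exp (- (up x + dn x) * t) else 0)"
| "mtp_k S up dn (Suc k) t x y =
     (if x = y then exp (- (up x + dn x) * t) else 0)
     + integral {0..t} (\<lambda>s. exp (- (up x + dn x) * s) *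
         ((if x + 1 \<in> S then up x * mtp_k S up dn k (t - s) (x + 1) y else 0)
        + (if x - 1 \<in> S then dn x * mtp_k S up dn k (t - s) (x - 1) y else 0)))"

definition mtp :: "int set \<Rightarrow> (int \<Rightarrow> real) \<Rightarrow> (int \<Rightarrow> real) \<Rightarrow> real \<Rightarrow> int \<Rightarrow> int \<Rightarrow> real" where
  "mtp S up dn t x y = (SUP k. mtp_k S up dn k t x y)"

definition bd_p :: "int set \<Rightarrow> (int \<Rightarrow> real) \<Rightarrow> (int \<Rightarrow> real) \<Rightarrow> real \<Rightarrow> int \<Rightarrow> int \<Rightarrow> real" where
  "bd_p I lam mu = mtp I lam mu"

definition bd_phat :: "int set \<Rightarrow> (int \<Rightarrow> real) \<Rightarrow> (int \<Rightarrow> real) \<Rightarrow> real \<Rightarrow> int \<Rightarrow> int \<Rightarrow> real" where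
  "bd_phat I lam mu = mtp I (\<lambda>x. mu (x + 1)) lam"

definition bd_pi :: "(int \<Rightarrow> real) \<Rightarrow> (int \<Rightarrow> real) \<Rightarrow> int \<Rightarrow> real" where
  "bd_pi lam mu x = (if x \<ge> 0 then (\<Prod>i\<in>{1..x}. lam (i - 1) / mu i)
                     else (\<Prod>i\<in>{1..-x}. mu (x + i) / lam (x + i - 1)))"

definition bd_pihat :: "(int \<Rightarrow> real) \<Rightarrow> (int \<Rightarrow> real) \<Rightarrow> int \<Rightarrow> real" where
  "bd_pihat lam mu x = (if x \<ge> 0 then (\<Prod>i\<in>{1..x}. mu i / lam i)
                        else (\<Prod>i\<in>{1..-x}. lam (x + i) / mu (x + i)))"

definition natural_boundaries :: "int set \<Rightarrow> (int \<Rightarrow> real) \<Rightarrow> (int \<Rightarrow> real) \<Rightarrow> bool" where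
  "natural_boundaries I lam mu = (let pp = bd_pi lam mu in
     (if I = {0..} then
        (\<Sum>j::nat. ennreal (1 / (lam (int j) * pp (int j)) * (\<Sum>i\<in>{0..int j}. pp i))) = (\<infinity>::ennreal)
      \<and> (\<Sum>j::nat. ennreal (1 / (lam (int j) * pp (int j))) * (\<Sum>i::nat. ennreal (pp (int j + 1 + int i)))) = (\<infinity>::ennreal)
      else
        (\<Sum>k::nat. ennreal (1 / (lam (int k + 1) * pp (int k + 1)) * (\<Sum>i\<in>{1..int k + 1}. pp i))) = (\<infinity>::ennreal)
      \<and> (\<Sum>k::nat. ennreal (pp (int k + 1) * (\<Sum>i\<in>{1..int k}. 1 / (lam i * pp i)))) = (\<infinity>::ennreal)
      \<and> (\<Sum>k::nat. ennreal (1 / (lam (- int k - 1) * pp (- int k - 1)) * (\<Sum>i\<in>{- int k..-1}. pp i))) = (\<infinity>::ennreal)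
      \<and> (\<Sum>k::nat. ennreal (pp (- int k - 1) * (\<Sum>i\<in>{- int k - 1..-1}. 1 / (lam i * pp i)))) = (\<infinity>::ennreal)))"

text \<open>Weyl chamber W^n in I^n, as strictly increasing lists (index i stands for i+1).\<close>
definition Wch :: "int set \<Rightarrow> nat \<Rightarrow> int list set" where
  "Wch I n = {xs. length xs = n \<and> set xs \<subseteq> I \<and> sorted_wrt (<) xs}"

definition interl1 :: "int list \<Rightarrow> int list \<Rightarrow> bool" where
  "interl1 x y = (\<forall>i<length y. x ! i \<le> y ! i \<and> y ! i < x ! (i + 1))"

definition interl0 :: "int list \<Rightarrow> int list \<Rightarrow> bool" where
  "interl0 x y = ((\<forall>i<length y. y ! i \<le> x ! i) \<and> (\<forall>i. i + 1 < length y \<longrightarrow> x ! i < y ! (i + 1)))"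

definition KM :: "nat \<Rightarrow> (int \<Rightarrow> int \<Rightarrow> real) \<Rightarrow> int list \<Rightarrow> int list \<Rightarrow> real" where
  "KM n k x y = det (mat n n (\<lambda>(i, j). k (x ! i) (y ! j)))"

end

theory Submission
  imports Defs
begin

text \<open>Write \<open>F(x, y) = \<Sum>z\<le>y. p(x, z)\<close>. An interlacing constraint confines the summation variable to
  a product of intervals, so by multilinearity both sides of each identity are determinants of
  increments of \<open>F\<close>: on one side directly, on the other after moving the weights across by reversibility
  and using Siegmund duality \<open>F(x, y) = \<Sum>w\<ge>x. q(y, w)\<close> with the dual transition function \<open>q\<close>. Row and
  column operations identify the two determinants; for \<open>n + 1\<close> versus \<open>n\<close> particles this uses
  \<open>\<Sum>z. p(x, z) = 1\<close>.

  For the duality, the forward equation of \<open>p\<close> summed over \<open>z \<le> y\<close> is the backward equation of the dual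
  chain in \<open>y\<close>, provided no mass escapes through \<open>-\<infinity>\<close>. Minimality of the dual transition function then
  gives one inequality, and the same argument with the two chains exchanged gives the other. A flux
  \<open>c > 0\<close> through infinity would force the time-integrated density with respect to the reversing measure
  to be so large that the divergence of the boundary series contradicts its finite total mass.\<close>

section \<open>Feller iteration\<close>

text \<open>The index is shifted: \<open>feller_iter a b q (Suc k)\<close> counts paths with at most \<open>k\<close> jumps, and
  \<open>feller_iter a b q 0 = 0\<close> makes the inductions on \<open>k\<close> start trivially. The chain is killed at rate
  \<open>q x - a x - b x\<close>.\<close>

primrec feller_iter :: "(int \<Rightarrow> real) \<Rightarrow> (int \<Rightarrow> real) \<Rightarrow> (int \<Rightarrow> real) \<Rightarrow> nat \<Rightarrow> real \<Rightarrow> int \<Rightarrow> int \<Rightarrow> real" where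
  "feller_iter a b q 0 t x y = 0"
| "feller_iter a b q (Suc k) t x y = exp (- q x * t) * ((if x = y then 1 else 0) +
     integral {0..t} (\<lambda>s. exp (q x * s) * (a x * feller_iter a b q k s (x + 1) y + b x * feller_iter a b q k s (x - 1) y)))"

definition minP :: "(int \<Rightarrow> real) \<Rightarrow> (int \<Rightarrow> real) \<Rightarrow> (int \<Rightarrow> real) \<Rightarrow> real \<Rightarrow> int \<Rightarrow> int \<Rightarrow> real" where
  "minP a b q t x y = (SUP k. feller_iter a b q k t x y)"

text \<open>Reflecting the line exchanges births and deaths, so statements about plus infinity yield
  their counterparts at minus infinity.\<close>

lemma feller_iter_reflect:
  "feller_iter (\<lambda>x. b (- x)) (\<lambda>x. a (- x)) (\<lambda>x. q (- x)) k t x y = feller_iter a b q k t (- x) (- y)"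
proof (induction k arbitrary: t x y)
  case (Suc k)
  have e: "- x + 1 = - (x - 1)" "- x - 1 = - (x + 1)" by auto
  show ?case
    unfolding feller_iter.simps Suc e by (simp add: algebra_simps)
qed simp

lemma minP_reflect:
  "minP (\<lambda>x. b (- x)) (\<lambda>x. a (- x)) (\<lambda>x. q (- x)) t x y = minP a b q t (- x) (- y)"
  unfolding minP_def feller_iter_reflect ..

section \<open>Backward and forward equations, reversibility\<close>

lemma linear_ode_zero:
  fixes f :: "real \<Rightarrow> real"
  assumes d: "\<And>t. t \<ge> 0 \<Longrightarrow> (f has_real_derivative - c * f t) (at t within {0..})"
    and "f 0 = 0" and t: "t \<ge> 0"
  shows "f t = 0"
proof -
  have "\<exists>k. \<forall>s\<in>{0..}. exp (c * s) * f s = k"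
  proof (rule has_field_derivative_zero_constant)
    fix s :: real assume s: "s \<in> {0..}"
    show "((\<lambda>s. exp (c * s) * f s) has_real_derivative 0) (at s within {0..})"
      by (rule derivative_eq_intros d refl | use s in simp)+
  qed simp
  then obtain k where k: "\<And>s. s \<ge> 0 \<Longrightarrow> exp (c * s) * f s = k" by auto
  from k[of 0] k[of t] assms show ?thesis by simp
qed

locale birth_death =
  fixes a b q :: "int \<Rightarrow> real"
  assumes a_nonneg: "a x \<ge> 0" and b_nonneg: "b x \<ge> 0" and rates_le: "a x + b x \<le> q x"
begin

abbreviation "Q \<equiv> feller_iter a b q"
abbreviation "P \<equiv> minP a b q"

lemma Q_0: "Q k 0 x y = (if k \<noteq> 0 \<and> x = y then 1 else 0)"
  by (cases k) auto

text \<open>Proved jointly: the derivative of stage \<open>Suc k\<close> comes from continuity of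
  the integrand at stage \<open>k\<close>, and differentiability there gives the continuity needed
  at the next stage.\<close>

lemma Q_backward_continuous:
  "continuous_on {0..} (\<lambda>t. Q k t x y) \<and>
   (\<forall>t\<ge>0. ((\<lambda>t. Q (Suc k) t x y) has_real_derivative
     - q x * Q (Suc k) t x y + a x * Q k t (x + 1) y + b x * Q k t (x - 1) y) (at t within {0..}))"
proof (induction k arbitrary: x y)
  case 0
  have "((\<lambda>t. Q (Suc 0) t x y) has_real_derivative - q x * Q (Suc 0) t x y) (at t within {0..})" for t
  proof -
    have "((\<lambda>t. exp (- q x * t) * (if x = y then 1 else 0)) has_real_derivative
        - q x * (exp (- q x * t) * (if x = y then 1 else 0))) (at t within {0..})"
      by (rule derivative_eq_intros refl | simp)+
    then show ?thesis by simp
  qed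
  then show ?case by simp
next
  case (Suc k)
  define g where "g s = exp (q x * s) * (a x * Q (Suc k) s (x + 1) y + b x * Q (Suc k) s (x - 1) y)" for s
  have cont: "continuous_on {0..} (\<lambda>t. Q (Suc k) t x y)" for x y
    unfolding continuous_on_eq_continuous_within using Suc[of x y] DERIV_continuous atLeast_iff by blast
  have contg: "continuous_on {0..T} g" for T
    unfolding g_def
    by (intro continuous_intros continuous_on_subset[OF cont]) auto
  have "((\<lambda>t. Q (Suc (Suc k)) t x y) has_real_derivative
      - q x * Q (Suc (Suc k)) t x y + a x * Q (Suc k) t (x + 1) y + b x * Q (Suc k) t (x - 1) y)
      (at t within {0..})" if t: "t \<ge> 0" for t
  proof -
    \<comment> \<open>The fundamental theorem of calculus is applied on a compact interval; its
      endpoint \<open>t + 1\<close> keeps \<open>t\<close> away from the right end.\<close>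
    have ev: "at t within {0..} = at t within {0..t+1}"
      by (rule at_within_nhd[of _ "{t - 1<..<t + 1}"]) auto
    have "((\<lambda>x. integral {0..x} g) has_real_derivative g t) (at t within {0..t+1})"
      using t by (intro integral_has_real_derivative contg) auto
    hence d: "((\<lambda>x. integral {0..x} g) has_real_derivative g t) (at t within {0..})"
      unfolding ev .
    have "((\<lambda>t. exp (- q x * t) * ((if x = y then 1 else 0) + integral {0..t} g)) has_real_derivative
       - q x * (exp (- q x * t) * ((if x = y then 1 else 0) + integral {0..t} g)) + exp (- q x * t) * g t)
       (at t within {0..})"
      by (rule derivative_eq_intros d refl | simp)+
    moreover have "exp (- q x * t) * g t = a x * Q (Suc k) t (x + 1) y + b x * Q (Suc k) t (x - 1) y"
      unfolding g_def mult.assoc[symmetric] exp_add[symmetric] by simp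
    ultimately show ?thesis
      unfolding feller_iter.simps(2)[of a b q "Suc k"] g_def by (simp only: add.assoc)
  qed
  with cont show ?case by blast
qed

lemma Q_continuous: "continuous_on {0..} (\<lambda>t. Q k t x y)"
  using Q_backward_continuous by blast

lemma Q_backward:
  "t \<ge> 0 \<Longrightarrow> ((\<lambda>t. Q (Suc k) t x y) has_real_derivative
     - q x * Q (Suc k) t x y + a x * Q k t (x + 1) y + b x * Q k t (x - 1) y) (at t within {0..})"
  using Q_backward_continuous by blast

lemma Q_integrable: "(\<lambda>s. exp (r * s) * Q k s x y) integrable_on {0..t}"
  by (rule integrable_continuous_interval)
     (intro continuous_intros continuous_on_subset[OF Q_continuous], auto)

text \<open>The difference \<open>D\<close> of the backward and forward right-hand sides satisfies \<open>D' = - q x D\<close> with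
  zero initial value, by the identity for one jump fewer.\<close>

lemma Q_backward_eq_forward:
  assumes "t \<ge> 0"
  shows "- q x * Q (Suc k) t x y + a x * Q k t (x + 1) y + b x * Q k t (x - 1) y
       = - q y * Q (Suc k) t x y + a (y - 1) * Q k t x (y - 1) + b (y + 1) * Q k t x (y + 1)"
  using assms
proof (induction k arbitrary: t x y)
  case 0
  then show ?case by simp
next
  case (Suc k)
  let ?B = "\<lambda>k t x y. - q x * Q (Suc k) t x y + a x * Q k t (x + 1) y + b x * Q k t (x - 1) y"
  let ?F = "\<lambda>k t x y. - q y * Q (Suc k) t x y + a (y - 1) * Q k t x (y - 1) + b (y + 1) * Q k t x (y + 1)"
  have "?B (Suc k) t x y - ?F (Suc k) t x y = 0"
  proof (rule linear_ode_zero[where f = "\<lambda>t. ?B (Suc k) t x y - ?F (Suc k) t x y" and c = "q x"])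
    fix t :: real assume t: "t \<ge> 0"
    have "((\<lambda>t. ?B (Suc k) t x y - ?F (Suc k) t x y) has_real_derivative
       (- q x * ?B (Suc k) t x y + a x * ?B k t (x + 1) y + b x * ?B k t (x - 1) y)
       - (- q y * ?B (Suc k) t x y + a (y - 1) * ?B k t x (y - 1) + b (y + 1) * ?B k t x (y + 1)))
       (at t within {0..})"
      by (intro DERIV_diff DERIV_add DERIV_cmult Q_backward t)
    moreover have "(- q x * ?B (Suc k) t x y + a x * ?B k t (x + 1) y + b x * ?B k t (x - 1) y)
       - (- q y * ?B (Suc k) t x y + a (y - 1) * ?B k t x (y - 1) + b (y + 1) * ?B k t x (y + 1))
       = - q x * (?B (Suc k) t x y - ?F (Suc k) t x y)"
      unfolding Suc.IH[OF t, of "x + 1" y] Suc.IH[OF t, of "x - 1" y]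
      by (simp del: feller_iter.simps(2) add: algebra_simps)
    ultimately show "((\<lambda>t. ?B (Suc k) t x y - ?F (Suc k) t x y) has_real_derivative
        - q x * (?B (Suc k) t x y - ?F (Suc k) t x y)) (at t within {0..})"
      by (simp only:)
  next
    show "?B (Suc k) 0 x y - ?F (Suc k) 0 x y = 0"
      unfolding Q_0 by auto
  qed (use Suc.prems in auto)
  then show ?case by linarith
qed

lemma Q_forward:
  "t \<ge> 0 \<Longrightarrow> ((\<lambda>t. Q (Suc k) t x y) has_real_derivative
     - q y * Q (Suc k) t x y + a (y - 1) * Q k t x (y - 1) + b (y + 1) * Q k t x (y + 1)) (at t within {0..})"
  using Q_backward[of t k x y] Q_backward_eq_forward[of t x k y] by (simp only:)

text \<open>The exponent \<open>r\<close> is free because later the forward equation of one chain is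
  read as the backward equation of the other, whose holding rate differs from \<open>q y\<close>. In
  integrated form the equation survives the limit in \<open>k\<close> without any differentiability
  of the limit.\<close>

lemma Q_forward_integrated:
  assumes t: "t \<ge> 0"
  shows "exp (r * t) * Q (Suc k) t x y - (if x = y then 1 else 0)
       = (r - q y) * integral {0..t} (\<lambda>s. exp (r * s) * Q (Suc k) s x y)
       + a (y - 1) * integral {0..t} (\<lambda>s. exp (r * s) * Q k s x (y - 1))
       + b (y + 1) * integral {0..t} (\<lambda>s. exp (r * s) * Q k s x (y + 1))"
proof -
  let ?f = "\<lambda>s. (r - q y) * (exp (r * s) * Q (Suc k) s x y) + a (y - 1) * (exp (r * s) * Q k s x (y - 1))
      + b (y + 1) * (exp (r * s) * Q k s x (y + 1))"
  have "(?f has_integral (exp (r * t) * Q (Suc k) t x y - exp (r * 0) * Q (Suc k) 0 x y)) {0..t}"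
  proof (rule fundamental_theorem_of_calculus[OF t])
    fix s assume s: "s \<in> {0..t}"
    have "((\<lambda>s. exp (r * s) * Q (Suc k) s x y) has_real_derivative ?f s) (at s within {0..})"
      by (rule derivative_eq_intros Q_forward refl | use s in \<open>simp add: algebra_simps del: feller_iter.simps(2)\<close>)+
    then show "((\<lambda>s. exp (r * s) * Q (Suc k) s x y) has_vector_derivative ?f s) (at s within {0..t})"
      unfolding has_real_derivative_iff_has_vector_derivative
      by (rule has_vector_derivative_within_subset) auto
  qed
  moreover have "(?f has_integral (r - q y) * integral {0..t} (\<lambda>s. exp (r * s) * Q (Suc k) s x y)
       + a (y - 1) * integral {0..t} (\<lambda>s. exp (r * s) * Q k s x (y - 1))
       + b (y + 1) * integral {0..t} (\<lambda>s. exp (r * s) * Q k s x (y + 1))) {0..t}"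
    by (intro has_integral_add has_integral_mult_right integrable_integral Q_integrable)
  ultimately have "exp (r * t) * Q (Suc k) t x y - exp (r * 0) * Q (Suc k) 0 x y
       = (r - q y) * integral {0..t} (\<lambda>s. exp (r * s) * Q (Suc k) s x y)
       + a (y - 1) * integral {0..t} (\<lambda>s. exp (r * s) * Q k s x (y - 1))
       + b (y + 1) * integral {0..t} (\<lambda>s. exp (r * s) * Q k s x (y + 1))"
    by (rule has_integral_unique)
  then show ?thesis
    unfolding Q_0 by (simp del: feller_iter.simps(2))
qed

text \<open>Detailed balance carries the backward equation in the starting point into the forward
  equation in the end point, so the difference of the two sides solves a homogeneous linear equation
  with zero initial value.\<close>

lemma Q_reversible:
  assumes db: "\<And>x. p x * a x = p (x + 1) * b (x + 1)" and "t \<ge> 0"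
  shows "p x * Q k t x y = p y * Q k t y x"
  using \<open>t \<ge> 0\<close>
proof (induction k arbitrary: t x y)
  case (Suc k)
  have "p x * Q (Suc k) t x y - p y * Q (Suc k) t y x = 0"
  proof (rule linear_ode_zero[where f = "\<lambda>t. p x * Q (Suc k) t x y - p y * Q (Suc k) t y x" and c = "q x"])
    fix t :: real assume t: "t \<ge> 0"
    have "((\<lambda>t. p x * Q (Suc k) t x y - p y * Q (Suc k) t y x) has_real_derivative
       p x * (- q x * Q (Suc k) t x y + a x * Q k t (x + 1) y + b x * Q k t (x - 1) y)
       - p y * (- q x * Q (Suc k) t y x + a (x - 1) * Q k t y (x - 1) + b (x + 1) * Q k t y (x + 1)))
       (at t within {0..})"
      by (intro DERIV_diff DERIV_cmult Q_forward Q_backward t)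
    moreover have "p x * (a x * Q k t (x + 1) y) = p y * (b (x + 1) * Q k t y (x + 1))"
    proof -
      have "p x * (a x * Q k t (x + 1) y) = b (x + 1) * (p (x + 1) * Q k t (x + 1) y)"
        using db[of x] by (simp add: mult.assoc[symmetric] mult.commute[of "b (x + 1)"])
      then show ?thesis
        unfolding Suc.IH[OF t, of "x + 1" y] by simp
    qed
    moreover have "p x * (b x * Q k t (x - 1) y) = p y * (a (x - 1) * Q k t y (x - 1))"
    proof -
      have "p x * (b x * Q k t (x - 1) y) = a (x - 1) * (p (x - 1) * Q k t (x - 1) y)"
        using db[of "x - 1"] by (simp add: mult.assoc[symmetric] mult.commute[of "a (x - 1)"])
      then show ?thesis
        unfolding Suc.IH[OF t, of "x - 1" y] by simp
    qed
    ultimately show "((\<lambda>t. p x * Q (Suc k) t x y - p y * Q (Suc k) t y x) has_real_derivative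
        - q x * (p x * Q (Suc k) t x y - p y * Q (Suc k) t y x)) (at t within {0..})"
      by (simp del: feller_iter.simps(2) add: algebra_simps)
  qed (use Suc.prems in \<open>auto simp: Q_0 simp del: feller_iter.simps(2)\<close>)
  then show ?case by simp
qed simp

section \<open>Positivity, monotonicity and minimality of the iterates\<close>

lemma Q_nonneg: "t \<ge> 0 \<Longrightarrow> Q k t x y \<ge> 0"
proof (induction k arbitrary: t x y)
  case (Suc k)
  then show ?case
    unfolding feller_iter.simps
    by (intro mult_nonneg_nonneg add_nonneg_nonneg integral_nonneg)
       (auto intro!: integral_nonneg mult_nonneg_nonneg add_nonneg_nonneg a_nonneg b_nonneg
         integrable_continuous_interval continuous_intros continuous_on_subset[OF Q_continuous])
qed simp

lemma Q_mono_Suc: "t \<ge> 0 \<Longrightarrow> Q k t x y \<le> Q (Suc k) t x y"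
proof (induction k arbitrary: t x y)
  case 0
  then show ?case using Q_nonneg by simp
next
  case (Suc k)
  show ?case
    unfolding feller_iter.simps(2)[of a b q "Suc k"] feller_iter.simps(2)[of a b q k t]
    by (intro mult_left_mono add_left_mono integral_le add_mono Suc.IH a_nonneg b_nonneg
         integrable_continuous_interval continuous_intros continuous_on_subset[OF Q_continuous]) auto
qed

text \<open>Minimality: by induction on the number of jumps, the backward iteration started from 0
  stays below every nonnegative supersolution of the integrated backward equation whose initial
  datum is the indicator of \<open>A\<close>.\<close>

lemma Q_sum_le_supersolution:
  assumes h: "\<And>t x. t \<ge> 0 \<Longrightarrow> h t x \<ge> 0"
    and int: "\<And>t x r. t \<ge> 0 \<Longrightarrow> (\<lambda>s. exp (r * s) * h s x) integrable_on {0..t}"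
    and super: "\<And>t x. t \<ge> 0 \<Longrightarrow> exp (q x * t) * h t x \<ge> (if x \<in> A then 1 else 0)
      + integral {0..t} (\<lambda>s. a x * (exp (q x * s) * h s (x + 1)) + b x * (exp (q x * s) * h s (x - 1)))"
    and A: "finite A" and "t \<ge> 0"
  shows "(\<Sum>y\<in>A. Q k t x y) \<le> h t x"
  using \<open>t \<ge> 0\<close>
proof (induction k arbitrary: t x)
  case 0
  then show ?case using h by simp
next
  case (Suc k)
  let ?J = "\<lambda>y. \<lambda>s. exp (q x * s) * (a x * Q k s (x + 1) y + b x * Q k s (x - 1) y)"
  have I: "?J y integrable_on {0..t}" for y
    by (intro integrable_continuous_interval continuous_intros continuous_on_subset[OF Q_continuous]) auto
  have "exp (q x * t) * (\<Sum>y\<in>A. Q (Suc k) t x y) = (\<Sum>y\<in>A. (if x = y then 1 else 0) + integral {0..t} (?J y))"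
    by (simp add: sum_distrib_left mult.assoc[symmetric] exp_add[symmetric])
  also have "\<dots> = (if x \<in> A then 1 else 0) + integral {0..t} (\<lambda>s. \<Sum>y\<in>A. ?J y s)"
    using A I by (simp add: sum.distrib integral_sum)
  finally have 1: "exp (q x * t) * (\<Sum>y\<in>A. Q (Suc k) t x y) =
      (if x \<in> A then 1 else 0) + integral {0..t} (\<lambda>s. \<Sum>y\<in>A. ?J y s)" .
  have 2: "integral {0..t} (\<lambda>s. \<Sum>y\<in>A. ?J y s)
     \<le> integral {0..t} (\<lambda>s. a x * (exp (q x * s) * h s (x + 1)) + b x * (exp (q x * s) * h s (x - 1)))"
  proof (rule integral_le)
    fix s assume s: "s \<in> {0..t}"
    have "(\<Sum>y\<in>A. ?J y s) = exp (q x * s) * (a x * (\<Sum>y\<in>A. Q k s (x + 1) y) + b x * (\<Sum>y\<in>A. Q k s (x - 1) y))"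
      by (simp only: sum_distrib_left[symmetric] sum.distrib)
    also have "\<dots> \<le> exp (q x * s) * (a x * h s (x + 1) + b x * h s (x - 1))"
      using s by (intro mult_left_mono add_mono Suc.IH a_nonneg b_nonneg) auto
    finally show "(\<Sum>y\<in>A. ?J y s) \<le> a x * (exp (q x * s) * h s (x + 1)) + b x * (exp (q x * s) * h s (x - 1))"
      by (simp add: algebra_simps)
  qed (use I A int Suc.prems in \<open>auto intro!: integrable_sum integrable_add integrable_on_mult_right\<close>)
  have "exp (q x * t) * (\<Sum>y\<in>A. Q (Suc k) t x y) \<le> exp (q x * t) * h t x"
    using super[OF Suc.prems, of x] 1 2 by linarith
  then show ?case by simp
qed

text \<open>The constant 1 is a supersolution, since the jump rates add up to at most
  \<open>q\<close>.\<close>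

lemma Q_sum_le_1:
  assumes A: "finite A" and t: "t \<ge> 0"
  shows "(\<Sum>y\<in>A. Q k t x y) \<le> 1"
proof (rule Q_sum_le_supersolution[OF _ _ _ A t, where h = "\<lambda>_ _. 1"])
  fix t :: real and x assume t: "t \<ge> 0"
  have "((\<lambda>s. q x * exp (q x * s)) has_integral (exp (q x * t) - exp (q x * 0))) {0..t}"
  proof (rule fundamental_theorem_of_calculus[OF t])
    fix s assume "s \<in> {0..t}"
    show "((\<lambda>s. exp (q x * s)) has_vector_derivative q x * exp (q x * s)) (at s within {0..t})"
      unfolding has_real_derivative_iff_has_vector_derivative[symmetric]
      by (rule derivative_eq_intros refl | simp)+
  qed
  hence e: "integral {0..t} (\<lambda>s. q x * exp (q x * s)) = exp (q x * t) - 1"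
    by (metis integral_unique mult_zero_right exp_zero)
  have "integral {0..t} (\<lambda>s. a x * (exp (q x * s) * 1) + b x * (exp (q x * s) * 1))
     \<le> integral {0..t} (\<lambda>s. q x * exp (q x * s))"
  proof (rule integral_le)
    fix s
    have "(a x + b x) * exp (q x * s) \<le> q x * exp (q x * s)"
      by (intro mult_right_mono rates_le) auto
    then show "a x * (exp (q x * s) * 1) + b x * (exp (q x * s) * 1) \<le> q x * exp (q x * s)"
      by (simp add: algebra_simps)
  qed (auto intro!: integrable_continuous_interval continuous_intros)
  with e show "exp (q x * t) * 1 \<ge> (if x \<in> A then 1 else 0)
      + integral {0..t} (\<lambda>s. a x * (exp (q x * s) * 1) + b x * (exp (q x * s) * 1))"
    by simp
qed (auto intro!: integrable_continuous_interval continuous_intros)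

end

section \<open>The minimal transition function\<close>

text \<open>Serves two limits: the number of jumps tending to infinity, and windows of target states
  growing to a half-line. The bound 1 keeps the integrals bounded.\<close>

lemma monotone_convergence_exp_weight:
  fixes f :: "nat \<Rightarrow> real \<Rightarrow> real"
  assumes int: "\<And>k. (\<lambda>s. exp (r * s) * f k s) integrable_on {0..t}"
    and mono: "\<And>k s. s \<in> {0..t} \<Longrightarrow> f k s \<le> f (Suc k) s"
    and bd: "\<And>k s. s \<in> {0..t} \<Longrightarrow> 0 \<le> f k s \<and> f k s \<le> 1"
    and lim: "\<And>s. s \<in> {0..t} \<Longrightarrow> (\<lambda>k. f k s) \<longlonglongrightarrow> g s"
  shows "(\<lambda>s. exp (r * s) * g s) integrable_on {0..t}"
    and "(\<lambda>k. integral {0..t} (\<lambda>s. exp (r * s) * f k s)) \<longlonglongrightarrow> integral {0..t} (\<lambda>s. exp (r * s) * g s)"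
proof -
  have e: "(\<lambda>s. exp (r * s)) integrable_on {0..t}"
    by (intro integrable_continuous_interval continuous_intros)
  have "\<bar>integral {0..t} (\<lambda>s. exp (r * s) * f k s)\<bar> \<le> integral {0..t} (\<lambda>s. exp (r * s))" for k
    unfolding real_norm_def[symmetric] using bd
    by (intro integral_norm_bound_integral int e) (auto simp: abs_mult)
  hence "bounded (range (\<lambda>k. integral {0..t} (\<lambda>s. exp (r * s) * f k s)))"
    by (intro boundedI) auto
  hence "(\<lambda>s. exp (r * s) * g s) integrable_on {0..t} \<and>
    (\<lambda>k. integral {0..t} (\<lambda>s. exp (r * s) * f k s)) \<longlonglongrightarrow> integral {0..t} (\<lambda>s. exp (r * s) * g s)"
    by (intro monotone_convergence_increasing int) (auto intro!: tendsto_intros lim mono)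
  then show "(\<lambda>s. exp (r * s) * g s) integrable_on {0..t}"
    "(\<lambda>k. integral {0..t} (\<lambda>s. exp (r * s) * f k s)) \<longlonglongrightarrow> integral {0..t} (\<lambda>s. exp (r * s) * g s)"
    by auto
qed

lemma has_sum_int_atLeast_imp_LIMSEQ:
  fixes f :: "int \<Rightarrow> real"
  assumes "(f has_sum S) {y..}"
  shows "(\<lambda>n. \<Sum>w\<in>{y..y + int n}. f w) \<longlonglongrightarrow> S"
proof -
  have "((\<lambda>n::nat. f (y + int n)) has_sum S) UNIV"
    by (subst has_sum_reindex_bij_witness[of UNIV "\<lambda>w. nat (w - y)" "\<lambda>n. y + int n" "{y..}" f _ S S])
       (use assms in auto)
  hence "(\<lambda>n. \<Sum>i\<le>n. f (y + int i)) \<longlonglongrightarrow> S"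
    using has_sum_imp_sums sums_def_le by blast
  moreover have "(\<Sum>i\<le>n. f (y + int i)) = (\<Sum>w\<in>{y..y + int n}. f w)" for n
    by (rule sum.reindex_bij_witness[where j = "\<lambda>n. y + int n" and i = "\<lambda>w. nat (w - y)"]) auto
  ultimately show ?thesis by simp
qed

text \<open>For a chain with upward rates \<open>a\<close> and reversing measure \<open>p\<close>, the premises say that \<open>p u\<close> is a
  measure carrying an upward flux of at least \<open>c\<close> through all high levels; so no finite such
  measure exists, which is what it means that \<open>+\<infinity>\<close> is not an exit boundary.\<close>

definition no_exit :: "(int \<Rightarrow> real) \<Rightarrow> (int \<Rightarrow> real) \<Rightarrow> bool" where
  "no_exit a p \<longleftrightarrow> (\<forall>u c m K. c > 0 \<longrightarrow> (\<forall>i. u i \<ge> 0) \<longrightarrow>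
     (\<forall>i\<ge>m. a i * p i * (u i - u (i + 1)) \<ge> c) \<longrightarrow> \<not> (\<forall>l. (\<Sum>i\<in>{m..l}. p i * u i) \<le> (K::real)))"

context birth_death
begin

lemma Q_le_1: "t \<ge> 0 \<Longrightarrow> Q k t x y \<le> 1"
  using Q_sum_le_1[of "{y}" t k x] by simp

lemma Q_tendsto_P: "t \<ge> 0 \<Longrightarrow> (\<lambda>k. Q k t x y) \<longlonglongrightarrow> P t x y"
  unfolding minP_def
  by (rule LIMSEQ_incseq_SUP) (auto intro!: bdd_aboveI[where M = 1] Q_le_1 incseq_SucI Q_mono_Suc)

lemma P_nonneg: "t \<ge> 0 \<Longrightarrow> P t x y \<ge> 0"
  using Q_tendsto_P[of t x y] Q_nonneg by (intro LIMSEQ_le_const) auto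

lemma P_sum_tendsto: "t \<ge> 0 \<Longrightarrow> (\<lambda>k. \<Sum>y\<in>A. Q k t x y) \<longlonglongrightarrow> (\<Sum>y\<in>A. P t x y)"
  by (intro tendsto_sum Q_tendsto_P)

lemma P_sum_le_1: "t \<ge> 0 \<Longrightarrow> finite A \<Longrightarrow> (\<Sum>y\<in>A. P t x y) \<le> 1"
  using P_sum_tendsto[of t x A] Q_sum_le_1 by (intro LIMSEQ_le_const2) auto

lemma P_summable: "t \<ge> 0 \<Longrightarrow> P t x summable_on A"
  by (rule nonneg_bdd_above_summable_on) (auto intro!: bdd_aboveI[where M = 1] P_sum_le_1 P_nonneg)

lemma P_infsum_le_1: "t \<ge> 0 \<Longrightarrow> infsum (P t x) A \<le> 1"
  by (intro infsum_le_finite_sums P_summable P_sum_le_1) auto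

lemma P_integrable: "(\<lambda>s. exp (r * s) * P s x y) integrable_on {0..t}"
  and Q_integral_tendsto:
    "(\<lambda>k. integral {0..t} (\<lambda>s. exp (r * s) * Q k s x y)) \<longlonglongrightarrow> integral {0..t} (\<lambda>s. exp (r * s) * P s x y)"
  by (rule monotone_convergence_exp_weight[where f = "\<lambda>k s. Q k s x y"];
      auto intro: Q_integrable Q_mono_Suc Q_nonneg Q_le_1 Q_tendsto_P simp del: feller_iter.simps(2))+

lemma P_forward:
  assumes t: "t \<ge> 0"
  shows "exp (r * t) * P t x y - (if x = y then 1 else 0)
       = (r - q y) * integral {0..t} (\<lambda>s. exp (r * s) * P s x y)
       + a (y - 1) * integral {0..t} (\<lambda>s. exp (r * s) * P s x (y - 1))
       + b (y + 1) * integral {0..t} (\<lambda>s. exp (r * s) * P s x (y + 1))"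
proof (rule LIMSEQ_unique)
  show "(\<lambda>k. exp (r * t) * Q (Suc k) t x y - (if x = y then 1 else 0))
     \<longlonglongrightarrow> exp (r * t) * P t x y - (if x = y then 1 else 0)"
    by (intro tendsto_intros LIMSEQ_Suc[OF Q_tendsto_P] t)
  show "(\<lambda>k. exp (r * t) * Q (Suc k) t x y - (if x = y then 1 else 0)) \<longlonglongrightarrow>
       (r - q y) * integral {0..t} (\<lambda>s. exp (r * s) * P s x y)
       + a (y - 1) * integral {0..t} (\<lambda>s. exp (r * s) * P s x (y - 1))
       + b (y + 1) * integral {0..t} (\<lambda>s. exp (r * s) * P s x (y + 1))"
    unfolding Q_forward_integrated[OF t]
    by (intro tendsto_intros Q_integral_tendsto LIMSEQ_Suc[OF Q_integral_tendsto])
qed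

lemma P_reversible:
  assumes db: "\<And>x. p x * a x = p (x + 1) * b (x + 1)" and t: "t \<ge> 0"
  shows "p x * P t x y = p y * P t y x"
proof (rule LIMSEQ_unique)
  show "(\<lambda>k. p x * Q k t x y) \<longlonglongrightarrow> p x * P t x y"
    by (intro tendsto_intros Q_tendsto_P t)
  show "(\<lambda>k. p x * Q k t x y) \<longlonglongrightarrow> p y * P t y x"
    unfolding Q_reversible[of p, OF db t, of x _ y] by (intro tendsto_intros Q_tendsto_P t)
qed

lemma P_infsum_le_supersolution:
  assumes h: "\<And>t x. t \<ge> 0 \<Longrightarrow> h t x \<ge> 0"
    and int: "\<And>t x r. t \<ge> 0 \<Longrightarrow> (\<lambda>s. exp (r * s) * h s x) integrable_on {0..t}"
    and super: "\<And>t x. t \<ge> 0 \<Longrightarrow> exp (q x * t) * h t x \<ge> (if x \<in> A then 1 else 0)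
      + integral {0..t} (\<lambda>s. a x * (exp (q x * s) * h s (x + 1)) + b x * (exp (q x * s) * h s (x - 1)))"
    and t: "t \<ge> 0"
  shows "infsum (P t x) A \<le> h t x"
proof (rule infsum_le_finite_sums[OF P_summable[OF t]])
  fix F assume F: "finite F" "F \<subseteq> A"
  have "(\<Sum>y\<in>F. Q k t x y) \<le> h t x" for k
  proof (rule Q_sum_le_supersolution[OF h int _ F(1) t])
    fix t :: real and x assume "t \<ge> 0"
    from super[OF this, of x] F(2)
    show "(if x \<in> F then 1 else 0) + integral {0..t} (\<lambda>s. a x * (exp (q x * s) * h s (x + 1))
         + b x * (exp (q x * s) * h s (x - 1))) \<le> exp (q x * t) * h t x"
      by (auto split: if_splits)
  qed
  then show "sum (P t x) F \<le> h t x"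
    using P_sum_tendsto[OF t, of x F] by (intro LIMSEQ_le_const2) auto
qed

section \<open>Tail sums and the flux through infinity\<close>

lemma P_tail_tendsto:
  "t \<ge> 0 \<Longrightarrow> (\<lambda>n. \<Sum>w\<in>{y..y + int n}. P t x w) \<longlonglongrightarrow> infsum (P t x) {y..}"
  by (intro has_sum_int_atLeast_imp_LIMSEQ has_sum_infsum P_summable)

lemma
  shows P_tail_integrable: "(\<lambda>s. exp (r * s) * infsum (P s x) {y..}) integrable_on {0..t}"
    and P_tail_integral_tendsto:
    "(\<lambda>n. integral {0..t} (\<lambda>s. exp (r * s) * (\<Sum>w\<in>{y..y + int n}. P s x w)))
       \<longlonglongrightarrow> integral {0..t} (\<lambda>s. exp (r * s) * infsum (P s x) {y..})"
proof -
  have *: "(\<lambda>s. exp (r * s) * (\<Sum>w\<in>{y..y + int n}. P s x w)) integrable_on {0..t}" for n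
    unfolding sum_distrib_left by (intro integrable_sum P_integrable) auto
  note conv = monotone_convergence_exp_weight[where f = "\<lambda>n s. \<Sum>w\<in>{y..y + int n}. P s x w", OF *]
  show "(\<lambda>s. exp (r * s) * infsum (P s x) {y..}) integrable_on {0..t}"
    by (rule conv) (auto intro!: P_tail_tendsto sum_mono2 P_nonneg sum_nonneg P_sum_le_1)
  show "(\<lambda>n. integral {0..t} (\<lambda>s. exp (r * s) * (\<Sum>w\<in>{y..y + int n}. P s x w)))
       \<longlonglongrightarrow> integral {0..t} (\<lambda>s. exp (r * s) * infsum (P s x) {y..})"
    by (rule conv) (auto intro!: P_tail_tendsto sum_mono2 P_nonneg sum_nonneg P_sum_le_1)
qed

abbreviation "PI r t x y \<equiv> integral {0..t} (\<lambda>s. exp (r * s) * P s x y)"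

lemma PI_sum: "finite A \<Longrightarrow> (\<Sum>w\<in>A. PI r t x w) = integral {0..t} (\<lambda>s. exp (r * s) * (\<Sum>w\<in>A. P s x w))"
  unfolding sum_distrib_left by (intro integral_sum[symmetric] P_integrable) auto

lemma PI_nonneg: "PI r t x y \<ge> 0"
  by (intro integral_nonneg P_integrable) (auto intro!: mult_nonneg_nonneg P_nonneg)

text \<open>The forward equations over the window telescope; what is left is the exchange across its
  lower edge and the net flux out of its upper edge. The rates are balanced only above
  \<open>y\<close>, so that a chain killed at \<open>y\<close> itself is covered; hence
  \<open>q y - a y\<close> in place of \<open>b y\<close>.\<close>

lemma P_partial_tail:
  assumes t: "t \<ge> 0" and qe: "\<And>w. w > y \<Longrightarrow> q w = a w + b w"
  shows "exp (r * t) * (\<Sum>w\<in>{y..y + int n}. P t x w) - (if x \<in> {y..y + int n} then 1 else 0)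
     = r * (\<Sum>w\<in>{y..y + int n}. PI r t x w) + a (y - 1) * PI r t x (y - 1) - (q y - a y) * PI r t x y
       - (a (y + int n) * PI r t x (y + int n) - b (y + int n + 1) * PI r t x (y + int n + 1))"
proof (induction n)
  case 0
  show ?case using P_forward[OF t, of r x y] by (simp add: algebra_simps)
next
  case (Suc n)
  have set: "{y..y + int (Suc n)} = insert (y + int (Suc n)) {y..y + int n}" by auto
  have q: "q (y + int (Suc n)) = a (y + int (Suc n)) + b (y + int (Suc n))" by (intro qe) auto
  have s: "(\<Sum>w\<in>{y..y + int (Suc n)}. f w) = f (y + int (Suc n)) + (\<Sum>w\<in>{y..y + int n}. f w)" for f :: "int \<Rightarrow> real"
    unfolding set by simp
  have i: "(if x \<in> {y..y + int (Suc n)} then 1 else 0) =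
      (if x = y + int (Suc n) then 1 else 0) + (if x \<in> {y..y + int n} then 1 else 0 :: real)"
    by auto
  have "y + int (Suc n) - 1 = y + int n" "y + int n + 1 = y + int (Suc n)" by auto
  then show ?case
    using P_forward[OF t, of r x "y + int (Suc n)"] Suc unfolding s i q
    by (simp add: algebra_simps)
qed

text \<open>The flux \<open>fl\<close> out of the top of the window converges to the defect
  \<open>c\<close> between the two sides. If \<open>c > 0\<close>, then \<open>PI / p\<close> would
  be a density with flux above \<open>c / 2\<close> through all high levels and with finite total
  mass, which \<open>no_exit\<close> forbids.\<close>

lemma P_tail_ge:
  assumes p: "\<And>x. p x > 0" and db: "\<And>x. p x * a x = p (x + 1) * b (x + 1)" and ne: "no_exit a p"
    and t: "t \<ge> 0" and qe: "\<And>w. w > y \<Longrightarrow> q w = a w + b w"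
  shows "exp (r * t) * infsum (P t x) {y..} \<ge> (if x \<ge> y then 1 else 0)
    + r * integral {0..t} (\<lambda>s. exp (r * s) * infsum (P s x) {y..})
    + a (y - 1) * PI r t x (y - 1) - (q y - a y) * PI r t x y"
proof -
  define fl where "fl i = a i * PI r t x i - b (i + 1) * PI r t x (i + 1)" for i
  define c where "c = (if x \<ge> y then 1 else 0)
    + r * integral {0..t} (\<lambda>s. exp (r * s) * infsum (P s x) {y..})
    + a (y - 1) * PI r t x (y - 1) - (q y - a y) * PI r t x y - exp (r * t) * infsum (P t x) {y..}"
  have fl: "fl (y + int n) = (if x \<in> {y..y + int n} then 1 else 0)
     + r * integral {0..t} (\<lambda>s. exp (r * s) * (\<Sum>w\<in>{y..y + int n}. P s x w)) + a (y - 1) * PI r t x (y - 1)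
     - (q y - a y) * PI r t x y - exp (r * t) * (\<Sum>w\<in>{y..y + int n}. P t x w)" for n
    using P_partial_tail[OF t qe, of y r x n] unfolding fl_def PI_sum[OF finite_atLeastAtMost_int]
    by (simp add: algebra_simps)
  have "(\<lambda>n. if x \<in> {y..y + int n} then 1 else 0 :: real) \<longlonglongrightarrow> (if x \<ge> y then 1 else 0)"
    by (rule tendsto_eventually, rule eventually_sequentiallyI[of "nat (x - y)"]) auto
  hence lim: "(\<lambda>n. fl (y + int n)) \<longlonglongrightarrow> c"
    unfolding fl c_def by (intro tendsto_intros P_tail_integral_tendsto P_tail_tendsto t)
  have "\<not> c > 0"
  proof
    assume c: "c > 0"
    hence "eventually (\<lambda>n. fl (y + int n) > c / 2) sequentially"
      by (intro order_tendstoD[OF lim]) auto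
    then obtain N where N: "\<And>n. n \<ge> N \<Longrightarrow> fl (y + int n) > c / 2"
      by (auto simp: eventually_sequentially)
    \<comment> \<open>The density of the time-integrated law with respect to \<open>p\<close>;
      detailed balance turns the flux into a discrete gradient of it.\<close>
    define u where "u i = PI r t x i / p i" for i
    have "fl i = a i * p i * (u i - u (i + 1))" for i
    proof -
      have "a i * p i * (u i - u (i + 1)) = a i * (p i * u i) - p i * a i * u (i + 1)"
        by (simp add: algebra_simps)
      also have "\<dots> = a i * (p i * u i) - b (i + 1) * (p (i + 1) * u (i + 1))"
        unfolding db by simp
      finally show ?thesis
        using p[of i] p[of "i + 1"] unfolding fl_def u_def by simp
    qed
    moreover have "fl i \<ge> c / 2" if "i \<ge> y + int N" for i
    proof -
      from that have "nat (i - y) \<ge> N" "y + int (nat (i - y)) = i" by linarith+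
      with N[of "nat (i - y)"] show ?thesis by simp
    qed
    ultimately have "a i * p i * (u i - u (i + 1)) \<ge> c / 2" if "i \<ge> y + int N" for i
      using that by simp
    moreover have "u i \<ge> 0" for i
      unfolding u_def using PI_nonneg p less_imp_le by (metis divide_nonneg_pos)
    \<comment> \<open>The total mass is at most the integrated weight because \<open>P\<close> is
      substochastic.\<close>
    moreover have "(\<Sum>i\<in>A. p i * u i) \<le> integral {0..t} (\<lambda>s. exp (r * s))" if A: "finite A" for A
    proof -
      have "(\<Sum>i\<in>A. p i * u i) = (\<Sum>i\<in>A. PI r t x i)"
        using p by (intro sum.cong refl) (simp add: u_def less_imp_neq[symmetric])
      also have "\<dots> = integral {0..t} (\<lambda>s. exp (r * s) * (\<Sum>w\<in>A. P s x w))"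
        by (rule PI_sum[OF A])
      also have "\<dots> \<le> integral {0..t} (\<lambda>s. exp (r * s))"
      proof (rule integral_le)
        show "(\<lambda>s. exp (r * s) * (\<Sum>w\<in>A. P s x w)) integrable_on {0..t}"
          unfolding sum_distrib_left by (intro integrable_sum P_integrable A)
        show "(\<lambda>s. exp (r * s)) integrable_on {0..t}"
          by (intro integrable_continuous_interval continuous_intros)
      qed (auto intro!: P_sum_le_1 A mult_left_le)
      finally show ?thesis .
    qed
    ultimately show False
      using ne c unfolding no_exit_def
      by (metis (no_types, lifting) finite_atLeastAtMost_int half_gt_zero)
  qed
  then show ?thesis unfolding c_def by linarith
qed

end

section \<open>Comparison with the transition function \<open>mtp\<close>\<close>

lemma integral_reflect_interval:
  fixes h :: "real \<Rightarrow> real"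
  shows "integral {0..t} (\<lambda>s. h (t - s)) = integral {0..t} h"
proof -
  have "integral {0..t} (\<lambda>s. h (t - s)) = integral {- t..0} (\<lambda>u. h (u + t))"
    using Henstock_Kurzweil_Integration.integral_reflect_real[of 0 "- t" "\<lambda>u. h (u + t)"] by simp
  also have "\<dots> = integral {0..t} h"
    using integral_shift_real_ivl[of 0 t t h] by simp
  finally show ?thesis .
qed

text \<open>\<open>mtp_k\<close> integrates over the first waiting time, \<open>feller_iter\<close>
  over the time left after it; the substitution \<open>u = t - s\<close> matches them. The index is
  shifted because of the empty stage 0 of \<open>feller_iter\<close>.\<close>

lemma (in birth_death) mtp_k_eq_Q:
  assumes S: "\<And>x. x \<in> S \<Longrightarrow> q x = up x + dn x"
    "\<And>x. x \<in> S \<Longrightarrow> a x = (if x + 1 \<in> S then up x else 0)"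
    "\<And>x. x \<in> S \<Longrightarrow> b x = (if x - 1 \<in> S then dn x else 0)"
    and "x \<in> S" "t \<ge> 0"
  shows "mtp_k S up dn k t x y = Q (Suc k) t x y"
  using \<open>x \<in> S\<close> \<open>t \<ge> 0\<close>
proof (induction k arbitrary: t x)
  case 0
  then show ?case by (simp add: S)
next
  case (Suc k)
  define g where "g s = a x * Q (Suc k) s (x + 1) y + b x * Q (Suc k) s (x - 1) y" for s
  have "integral {0..t} (\<lambda>s. exp (- (up x + dn x) * s) *
         ((if x + 1 \<in> S then up x * mtp_k S up dn k (t - s) (x + 1) y else 0)
        + (if x - 1 \<in> S then dn x * mtp_k S up dn k (t - s) (x - 1) y else 0)))
      = integral {0..t} (\<lambda>s. exp (- q x * s) * g (t - s))"
  proof (rule integral_cong)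
    fix s assume "s \<in> {0..t}"
    hence "t - s \<ge> 0" by simp
    then show "exp (- (up x + dn x) * s) *
         ((if x + 1 \<in> S then up x * mtp_k S up dn k (t - s) (x + 1) y else 0)
        + (if x - 1 \<in> S then dn x * mtp_k S up dn k (t - s) (x - 1) y else 0)) = exp (- q x * s) * g (t - s)"
      using S[OF Suc.prems(1)] Suc.IH[of "x + 1" "t - s"] Suc.IH[of "x - 1" "t - s"]
      by (simp add: g_def del: feller_iter.simps(2))
  qed
  also have "\<dots> = integral {0..t} (\<lambda>s. (\<lambda>u. exp (- q x * (t - u)) * g u) (t - s))"
    by simp
  also have "\<dots> = integral {0..t} (\<lambda>u. exp (- q x * (t - u)) * g u)"
    by (rule integral_reflect_interval)
  also have "\<dots> = integral {0..t} (\<lambda>u. exp (- q x * t) * (exp (q x * u) * g u))"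
  proof (rule integral_cong)
    fix u
    have "exp (- q x * (t - u)) = exp (- q x * t) * exp (q x * u)"
      unfolding exp_add[symmetric] by (simp add: right_diff_distrib)
    then show "exp (- q x * (t - u)) * g u = exp (- q x * t) * (exp (q x * u) * g u)" by simp
  qed
  also have "\<dots> = exp (- q x * t) * integral {0..t} (\<lambda>u. exp (q x * u) * g u)"
    by simp
  finally show ?case
    unfolding mtp_k.simps(2) feller_iter.simps(2)[of a b q "Suc k"] g_def using S(1)[OF Suc.prems(1)]
    by (simp add: distrib_left del: feller_iter.simps(2))
qed

lemma (in birth_death) mtp_eq_P:
  assumes S: "\<And>x. x \<in> S \<Longrightarrow> q x = up x + dn x"
    "\<And>x. x \<in> S \<Longrightarrow> a x = (if x + 1 \<in> S then up x else 0)"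
    "\<And>x. x \<in> S \<Longrightarrow> b x = (if x - 1 \<in> S then dn x else 0)"
    and x: "x \<in> S" and t: "t \<ge> 0"
  shows "mtp S up dn t x y = P t x y"
proof -
  have eq: "mtp_k S up dn k t x y = Q (Suc k) t x y" for k
    by (rule mtp_k_eq_Q) (use assms in auto)
  have "(\<lambda>k. Q (Suc k) t x y) \<longlonglongrightarrow> (SUP k. Q (Suc k) t x y)"
    by (rule LIMSEQ_incseq_SUP)
       (auto intro!: bdd_aboveI[where M = 1] Q_le_1 incseq_SucI Q_mono_Suc t simp del: feller_iter.simps(2))
  then show ?thesis
    unfolding mtp_def eq by (rule LIMSEQ_unique) (rule LIMSEQ_Suc[OF Q_tendsto_P[OF t]])
qed

section \<open>Siegmund duality\<close>

lemma infsum_reflect: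
  fixes f :: "int \<Rightarrow> real"
  shows "infsum (\<lambda>w. f (- w)) {- y..} = infsum f {..y}"
  by (rule infsum_reindex_bij_witness[of _ uminus uminus]) auto

context birth_death
begin

lemma P_eq_0_outside:
  assumes up: "\<And>x. x \<in> I \<Longrightarrow> a x \<noteq> 0 \<Longrightarrow> x + 1 \<in> I"
    and down: "\<And>x. x \<in> I \<Longrightarrow> b x \<noteq> 0 \<Longrightarrow> x - 1 \<in> I"
    and "x \<in> I" "y \<notin> I"
  shows "P t x y = 0"
proof -
  have "Q k t x y = 0" for k
    using \<open>x \<in> I\<close>
  proof (induction k arbitrary: t x)
    case (Suc k)
    have z: "a x * Q k s (x + 1) y = 0" "b x * Q k s (x - 1) y = 0" for s
      using Suc.IH Suc.prems up down by fastforce+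
    show ?case
      unfolding feller_iter.simps(2) z using Suc.prems \<open>y \<notin> I\<close> by auto
  qed simp
  then show ?thesis by (simp add: minP_def)
qed

lemma birth_death_reflect: "birth_death (\<lambda>x. b (- x)) (\<lambda>x. a (- x)) (\<lambda>x. q (- x))"
  using a_nonneg b_nonneg rates_le by unfold_locales (auto simp: add.commute)

lemma P_lower_integrable: "(\<lambda>s. exp (r * s) * infsum (P s x) {..y}) integrable_on {0..t}"
  using birth_death.P_tail_integrable[OF birth_death_reflect, of r "- x" "- y" t]
  unfolding minP_reflect minus_minus infsum_reflect[of "P _ x"] .

text \<open>This is \<open>P_tail_ge\<close> for the reflected chain, whose detailed balance is the
  original one with the rates exchanged.\<close>

lemma P_lower_ge:
  assumes p: "\<And>x. p x > 0" and db: "\<And>x. p x * a x = p (x + 1) * b (x + 1)"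
    and ne: "no_exit (\<lambda>x. b (- x)) (\<lambda>x. p (- x))"
    and t: "t \<ge> 0" and qe: "\<And>w. w < y \<Longrightarrow> q w = a w + b w"
  shows "exp (r * t) * infsum (P t x) {..y} \<ge> (if x \<le> y then 1 else 0)
    + r * integral {0..t} (\<lambda>s. exp (r * s) * infsum (P s x) {..y})
    + b (y + 1) * PI r t x (y + 1) - (q y - b y) * PI r t x y"
proof -
  have 1: "p (- z) * b (- z) = p (- (z + 1)) * a (- (z + 1))" for z
    using db[of "- z - 1"] by simp
  have 2: "q (- w) = b (- w) + a (- w)" if "w > - y" for w
    using qe[of "- w"] that by simp
  have "- (- y - 1) = y + 1" "- x \<ge> - y \<longleftrightarrow> x \<le> y" by auto
  with birth_death.P_tail_ge[OF birth_death_reflect p 1 ne t 2, where y = "- y" and r = r and x = "- x"]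
  show ?thesis
    unfolding minP_reflect minus_minus infsum_reflect[of "P _ x"] by (simp only:)
qed

lemma P_tail_step: "t \<ge> 0 \<Longrightarrow> infsum (P t x) {y..} = P t x y + infsum (P t x) {y + 1..}"
proof -
  assume t: "t \<ge> 0"
  have "{y..} = insert y {y + 1..}" by auto
  then show ?thesis by (simp add: infsum_insert P_summable t)
qed

lemma P_lower_step: "t \<ge> 0 \<Longrightarrow> infsum (P t x) {..y} = P t x y + infsum (P t x) {..y - 1}"
proof -
  assume t: "t \<ge> 0"
  have "{..y} = insert y {..y - 1}" by auto
  then show ?thesis by (simp add: infsum_insert P_summable t)
qed

text \<open>Rewrites the exchange terms of \<open>P_tail_ge\<close>, so that its inequality relates
  only tail sums to one another.\<close>

lemma PI_tail:
  "PI r t x y = integral {0..t} (\<lambda>s. exp (r * s) * infsum (P s x) {y..})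
     - integral {0..t} (\<lambda>s. exp (r * s) * infsum (P s x) {y + 1..})"
  unfolding integral_diff[OF P_tail_integrable P_tail_integrable, symmetric]
  by (rule integral_cong) (simp add: P_tail_step[of _ x y] algebra_simps)

lemma PI_lower:
  "PI r t x y = integral {0..t} (\<lambda>s. exp (r * s) * infsum (P s x) {..y})
     - integral {0..t} (\<lambda>s. exp (r * s) * infsum (P s x) {..y - 1})"
  unfolding integral_diff[OF P_lower_integrable P_lower_integrable, symmetric]
  by (rule integral_cong) (simp add: P_lower_step[of _ x y] algebra_simps)

lemma P_infsum_nonneg: "t \<ge> 0 \<Longrightarrow> infsum (P t x) A \<ge> 0"
  by (intro infsum_nonneg P_nonneg)

text \<open>Cut the line between 0 and 1 and take \<open>r = 0\<close> in both one-sided bounds: the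
  exchange terms across the cut cancel and the two indicators add up to 1.\<close>

lemma P_conservative:
  assumes p: "\<And>x. p x > 0" and db: "\<And>x. p x * a x = p (x + 1) * b (x + 1)"
    and ne: "no_exit a p" "no_exit (\<lambda>x. b (- x)) (\<lambda>x. p (- x))"
    and qe: "\<And>w. q w = a w + b w" and t: "t \<ge> 0"
  shows "infsum (P t x) UNIV = 1"
proof -
  have "infsum (P t x) {..0} + infsum (P t x) {1..} \<ge> 1"
    using P_tail_ge[OF p db ne(1) t qe, where y = 1 and r = 0 and x = x]
      P_lower_ge[OF p db ne(2) t qe, where y = 0 and r = 0 and x = x]
    by (simp add: qe split: if_splits)
  moreover have "infsum (P t x) UNIV = infsum (P t x) {..0} + infsum (P t x) {1..}"
    by (subst infsum_Un_disjoint[symmetric]) (auto intro!: P_summable t arg_cong[of _ _ "infsum (P t x)"])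
  ultimately show ?thesis
    using P_infsum_le_1[OF t, of x UNIV] by linarith
qed

end

text \<open>Rates and weights live on all integers, with the jumps that leave \<open>I\<close>
  switched off and the weights kept positive, so that \<open>{0..}\<close> and \<open>UNIV\<close>
  are treated together. States off \<open>I\<close> are absorbing for the first chain.\<close>

locale siegmund_dual_pair =
  fixes I :: "int set" and a b p ph :: "int \<Rightarrow> real"
  assumes I_up: "x \<in> I \<Longrightarrow> x + 1 \<in> I"
    and a0: "a x \<ge> 0" and b0: "b x \<ge> 0"
    and outside: "x \<notin> I \<Longrightarrow> a x = 0" "x - 1 \<notin> I \<Longrightarrow> b x = 0"
    and p_pos: "p x > 0" and p_db: "p x * a x = p (x + 1) * b (x + 1)"
    and ph_pos: "ph x > 0" and ph_db: "x \<in> I \<Longrightarrow> ph x * b (x + 1) = ph (x + 1) * a (x + 1)"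
    and no_exits: "no_exit a p" "no_exit (\<lambda>x. b (- x)) (\<lambda>x. p (- x))" "no_exit (\<lambda>x. b (x + 1)) ph"
begin

sublocale D: birth_death a b "\<lambda>x. a x + b x"
  using a0 b0 by unfold_locales auto

text \<open>At a bottom state of \<open>I\<close> the rate \<open>a x\<close> stays in the total
  rate but leads nowhere: this is the killing of the dual chain.\<close>

sublocale H: birth_death "\<lambda>x. b (x + 1)" "\<lambda>x. if x - 1 \<in> I then a x else 0" "\<lambda>x. a x + b (x + 1)"
  using a0 b0 by unfold_locales auto

lemma I_up_le: "x \<in> I \<Longrightarrow> x \<le> y \<Longrightarrow> y \<in> I"
  using int_ge_induct[of x y "\<lambda>y. y \<in> I"] I_up by blast

lemma D_outside: "x \<in> I \<Longrightarrow> y \<notin> I \<Longrightarrow> D.P t x y = 0"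
  by (rule D.P_eq_0_outside) (auto intro: I_up outside)

lemma D_reversible: "t \<ge> 0 \<Longrightarrow> p x * D.P t x y = p y * D.P t y x"
  by (rule D.P_reversible[OF p_db])

lemma ph_db': "ph x * b (x + 1) = ph (x + 1) * (if x + 1 - 1 \<in> I then a (x + 1) else 0)"
  using ph_db[of x] outside(2)[of "x + 1"] by auto

lemma H_reversible: "t \<ge> 0 \<Longrightarrow> ph x * H.P t x y = ph y * H.P t y x"
  by (rule H.P_reversible[OF ph_db'])

lemma D_conservative: "t \<ge> 0 \<Longrightarrow> infsum (D.P t x) UNIV = 1"
  by (rule D.P_conservative[OF p_pos p_db no_exits(1,2) refl])

text \<open>For fixed \<open>x\<close>, the forward inequality summed over \<open>{..y}\<close> is,
  in the variable \<open>y\<close>, a supersolution inequality for the backward equation of the dual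
  chain, because \<open>PI\<close> at one state is a difference of two lower sums. Minimality of
  \<open>H.P\<close> gives the bound.\<close>

lemma dual_tail_le_lower:
  assumes t: "t \<ge> 0"
  shows "infsum (H.P t y) {x..} \<le> infsum (D.P t x) {..y}"
proof (rule H.P_infsum_le_supersolution[OF _ _ _ t, where h = "\<lambda>t y. infsum (D.P t x) {..y}"])
  fix t :: real and y :: int assume t: "t \<ge> 0"
  show "(\<lambda>s. exp (r * s) * infsum (D.P s x) {..y}) integrable_on {0..t}" for r
    by (rule D.P_lower_integrable)
  show "infsum (D.P t x) {..y} \<ge> 0"
    by (rule D.P_infsum_nonneg[OF t])
  \<comment> \<open>The holding rate of the dual chain at \<open>y\<close>; with this weight the
    terms in \<open>L y\<close> cancel.\<close>
  define r where "r = a y + b (y + 1)"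
  define L where "L z = integral {0..t} (\<lambda>s. exp (r * s) * infsum (D.P s x) {..z})" for z
  have L0: "L z \<ge> 0" for z
    unfolding L_def
    by (intro integral_nonneg D.P_lower_integrable) (auto intro!: mult_nonneg_nonneg D.P_infsum_nonneg)
  have "exp (r * t) * infsum (D.P t x) {..y} \<ge> (if x \<le> y then 1 else 0) + r * L y
     + b (y + 1) * (L (y + 1) - L y) - a y * (L y - L (y - 1))"
    using D.P_lower_ge[OF p_pos p_db no_exits(2) t refl, where y = y and r = r and x = x]
    unfolding D.PI_lower L_def by simp
  also have "(if x \<le> y then 1 else 0) + r * L y + b (y + 1) * (L (y + 1) - L y) - a y * (L y - L (y - 1))
     = (if y \<in> {x..} then 1 else 0) + b (y + 1) * L (y + 1) + a y * L (y - 1)"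
    unfolding r_def by (simp add: algebra_simps)
  finally have "(if y \<in> {x..} then 1 else 0) + b (y + 1) * L (y + 1) + a y * L (y - 1)
     \<le> exp (r * t) * infsum (D.P t x) {..y}" .
  \<comment> \<open>When \<open>y - 1\<close> is outside \<open>I\<close> the dual chain does not
    jump down, and the nonnegative term is dropped.\<close>
  moreover have "a y * L (y - 1) \<ge> (if y - 1 \<in> I then a y else 0) * L (y - 1)"
    using a0[of y] L0[of "y - 1"] by simp
  ultimately have "(if y \<in> {x..} then 1 else 0) + (b (y + 1) * L (y + 1) + (if y - 1 \<in> I then a y else 0) * L (y - 1))
     \<le> exp (r * t) * infsum (D.P t x) {..y}" by linarith
  moreover have "b (y + 1) * L (y + 1) + (if y - 1 \<in> I then a y else 0) * L (y - 1) = integral {0..t} (\<lambda>s.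
     b (y + 1) * (exp (r * s) * infsum (D.P s x) {..y + 1}) +
     (if y - 1 \<in> I then a y else 0) * (exp (r * s) * infsum (D.P s x) {..y - 1}))"
    unfolding L_def
    by (subst integral_add) (auto intro!: integrable_on_mult_right D.P_lower_integrable)
  ultimately show "(if y \<in> {x..} then 1 else 0) + integral {0..t} (\<lambda>s.
     b (y + 1) * (exp ((a y + b (y + 1)) * s) * infsum (D.P s x) {..y + 1}) +
     (if y - 1 \<in> I then a y else 0) * (exp ((a y + b (y + 1)) * s) * infsum (D.P s x) {..y - 1}))
    \<le> exp ((a y + b (y + 1)) * t) * infsum (D.P t x) {..y}"
    unfolding r_def by simp
qed

text \<open>The dual chain may be killed below \<open>I\<close>, so off \<open>I\<close> its tail is replaced by the trivial
  supersolution \<open>1\<close>; the rates \<open>b\<close> vanish on the edge.\<close>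

lemma lower_le_dual_tail:
  assumes t: "t \<ge> 0" and x: "x \<in> I"
  shows "infsum (D.P t x) {..y} \<le> infsum (H.P t y) {x..}"
proof -
  define h where "h t x = (if x \<in> I then infsum (H.P t y) {x..} else 1)" for t x
  have int: "(\<lambda>s. exp (r * s) * h s x) integrable_on {0..t}" for r t x
    by (cases "x \<in> I")
       (auto simp: h_def intro!: H.P_tail_integrable integrable_continuous_interval continuous_intros)
  have "infsum (D.P t x) {..y} \<le> h t x"
  proof (rule D.P_infsum_le_supersolution[OF _ int _ t])
    fix t :: real and x :: int assume t: "t \<ge> 0"
    show "h t x \<ge> 0"
      unfolding h_def using H.P_infsum_nonneg[OF t] by auto
    define r where "r = a x + b x"
    define L where "L z = integral {0..t} (\<lambda>s. exp (r * s) * infsum (H.P s y) {z..})" for z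
    have sp: "integral {0..t} (\<lambda>s. a x * (exp (r * s) * h s (x + 1)) + b x * (exp (r * s) * h s (x - 1)))
       = a x * integral {0..t} (\<lambda>s. exp (r * s) * h s (x + 1)) + b x * integral {0..t} (\<lambda>s. exp (r * s) * h s (x - 1))"
      by (subst integral_add) (auto intro!: integrable_on_mult_right int)
    have "(if x \<in> {..y} then 1 else 0) + integral {0..t} (\<lambda>s. a x * (exp (r * s) * h s (x + 1))
         + b x * (exp (r * s) * h s (x - 1))) \<le> exp (r * t) * h t x"
    proof (cases "x \<in> I")
      case False
      then have "a x = 0" "b x = 0"
        using outside I_up[of "x - 1"] by auto
      with False show ?thesis by (simp add: h_def r_def)
    next
      case True
      \<comment> \<open>Above \<open>x\<close> every state has its lower neighbour in
        \<open>I\<close>, so the dual chain is not killed there.\<close>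
      have qe: "a w + b (w + 1) = b (w + 1) + (if w - 1 \<in> I then a w else 0)" if "w > x" for w
        using I_up_le[OF True, of "w - 1"] that by auto
      \<comment> \<open>At \<open>x\<close> itself the total rate minus the upward rate of the dual
        chain is \<open>a x\<close>, whether this is a jump or a killing.\<close>
      have "exp (r * t) * infsum (H.P t y) {x..} \<ge> (if x \<le> y then 1 else 0) + r * L x
         + b x * (L (x - 1) - L x) - a x * (L x - L (x + 1))"
        using H.P_tail_ge[OF ph_pos ph_db' no_exits(3) t qe, where y = x and r = r and x = y]
        unfolding H.PI_tail L_def by simp
      also have "(if x \<le> y then 1 else 0) + r * L x + b x * (L (x - 1) - L x) - a x * (L x - L (x + 1))
         = (if x \<in> {..y} then 1 else 0) + (a x * L (x + 1) + b x * L (x - 1))"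
        unfolding r_def by (simp add: algebra_simps)
      also have "L (x + 1) = integral {0..t} (\<lambda>s. exp (r * s) * h s (x + 1))"
        unfolding L_def h_def using I_up[OF True] by simp
      also have "b x * L (x - 1) = b x * integral {0..t} (\<lambda>s. exp (r * s) * h s (x - 1))"
        unfolding L_def h_def using outside(2)[of x] by (cases "x - 1 \<in> I") simp_all
      also have "infsum (H.P t y) {x..} = h t x"
        using True by (simp add: h_def)
      finally show ?thesis unfolding sp .
    qed
    then show "(if x \<in> {..y} then 1 else 0) + integral {0..t} (\<lambda>s. a x * (exp ((a x + b x) * s) * h s (x + 1))
         + b x * (exp ((a x + b x) * s) * h s (x - 1))) \<le> exp ((a x + b x) * t) * h t x"
      unfolding r_def .
  qed
  then show ?thesis using x by (simp add: h_def)
qed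

lemma siegmund_duality:
  "t \<ge> 0 \<Longrightarrow> x \<in> I \<Longrightarrow> infsum (D.P t x) {..y} = infsum (H.P t y) {x..}"
  using dual_tail_le_lower lower_le_dual_tail by (intro antisym)

end

section \<open>Determinants summed over boxes\<close>

lemma has_sum_Diff_subset:
  fixes f :: "'a \<Rightarrow> real"
  assumes A: "(f has_sum s) A" and B: "(f has_sum s') B" and "B \<subseteq> A"
  shows "(f has_sum (s - s')) (A - B)"
proof -
  have "((\<lambda>x. if x \<in> B then f x else 0) has_sum s') A"
    by (rule has_sum_cong_neutral[THEN iffD1, OF _ _ _ B]) (use assms in auto)
  hence "((\<lambda>x. f x + - (if x \<in> B then f x else 0)) has_sum (s + - s')) A"
    by (intro has_sum_add A has_sum_uminusI)
  also have "?this \<longleftrightarrow> (f has_sum (s + - s')) (A - B)"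
    by (rule has_sum_cong_neutral) auto
  finally show ?thesis by simp
qed

definition list_box :: "nat \<Rightarrow> (nat \<Rightarrow> 'a set) \<Rightarrow> 'a list set" where
  "list_box n B = {xs. length xs = n \<and> (\<forall>j<n. xs ! j \<in> B j)}"

text \<open>Tonelli by induction on the length: nonnegativity lets the iterated sums imply
  summability over the product.\<close>

lemma has_sum_prod_list_box:
  fixes f :: "nat \<Rightarrow> 'a \<Rightarrow> real"
  assumes "\<And>j x. j < n \<Longrightarrow> x \<in> B j \<Longrightarrow> f j x \<ge> 0"
    and "\<And>j. j < n \<Longrightarrow> (f j has_sum c j) (B j)"
  shows "((\<lambda>xs. \<Prod>j<n. f j (xs ! j)) has_sum (\<Prod>j<n. c j)) (list_box n B)"
  using assms
proof (induction n arbitrary: f B c)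
  case 0
  have "list_box 0 B = {[]}" by (auto simp: list_box_def)
  then show ?case by (simp add: has_sum_finite_iff)
next
  case (Suc n)
  let ?B = "\<lambda>j. B (Suc j)"
  let ?g = "\<lambda>(x, xs). f 0 x * (\<Prod>j<n. f (Suc j) (xs ! j))"
  have IH: "((\<lambda>xs. \<Prod>j<n. f (Suc j) (xs ! j)) has_sum (\<Prod>j<n. c (Suc j))) (list_box n ?B)"
    by (rule Suc.IH[of ?B "\<lambda>j. f (Suc j)"]) (use Suc.prems in auto)
  have row: "((\<lambda>xs. ?g (x, xs)) has_sum (f 0 x * (\<Prod>j<n. c (Suc j)))) (list_box n ?B)" for x
    using has_sum_cmult_right[OF IH] by simp
  have col: "((\<lambda>x. f 0 x * (\<Prod>j<n. c (Suc j))) has_sum (c 0 * (\<Prod>j<n. c (Suc j)))) (B 0)"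
    using Suc.prems by (intro has_sum_cmult_left) auto
  have "?g summable_on (B 0 \<times> list_box n ?B)"
    using Suc.prems
    by (intro summable_on_SigmaI[OF row has_sum_imp_summable[OF col]])
       (auto simp: list_box_def intro!: mult_nonneg_nonneg prod_nonneg)
  hence "(?g has_sum (c 0 * (\<Prod>j<n. c (Suc j)))) (B 0 \<times> list_box n ?B)"
    by (rule has_sum_SigmaI[OF row col])
  also have "?this \<longleftrightarrow> ((\<lambda>xs. \<Prod>j<Suc n. f j (xs ! j)) has_sum (\<Prod>j<Suc n. c j)) (list_box (Suc n) B)"
  proof (rule has_sum_reindex_bij_witness[where j = "\<lambda>(x, xs). x # xs" and i = "\<lambda>xs. (hd xs, tl xs)"])
    fix xs assume "xs \<in> list_box (Suc n) B"
    then obtain y ys where "xs = y # ys" "length ys = n" "\<And>j. j < Suc n \<Longrightarrow> (y # ys) ! j \<in> B j"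
      by (cases xs) (auto simp: list_box_def)
    moreover from this(3)[of 0] this(3)[of "Suc j" for j] have "y \<in> B 0" "\<And>j. j < n \<Longrightarrow> ys ! j \<in> B (Suc j)"
      by auto
    ultimately show "(case (hd xs, tl xs) of (x, xs) \<Rightarrow> x # xs) = xs" "(hd xs, tl xs) \<in> B 0 \<times> list_box n ?B"
      by (auto simp: list_box_def)
  qed (auto simp: list_box_def prod.lessThan_Suc_shift less_Suc_eq_0_disj simp del: prod.lessThan_Suc)
  finally show ?case .
qed

lemma det_mat_transpose: "det (mat n n (\<lambda>(i, j). f j i)) = det (mat n n (\<lambda>(i, j). f i j :: 'a :: comm_ring_1))"
proof -
  have "mat n n (\<lambda>(i, j). f j i) = transpose_mat (mat n n (\<lambda>(i, j). f i j))"
    by (rule eq_matI) auto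
  then show ?thesis by (simp add: det_transpose[of _ n])
qed

lemma det_mat_expand:
  "det (mat n n (\<lambda>(i, j). f i j)) =
     (\<Sum>\<sigma>\<in>{\<sigma>. \<sigma> permutes {0..<n}}. signof \<sigma> * (\<Prod>i<n. f i (\<sigma> i :: nat) :: real))"
proof -
  have "(\<Prod>i = 0..<n. mat n n (\<lambda>(i, j). f i j) $$ (i, \<sigma> i)) = (\<Prod>i<n. f i (\<sigma> i))"
    if "\<sigma> permutes {0..<n}" for \<sigma>
    by (rule prod.cong) (use permutes_in_image[OF that] in \<open>auto simp: atLeast0LessThan\<close>)
  then show ?thesis
    by (subst det_def'[of _ n]) auto
qed

text \<open>Row \<open>i\<close> depends on the list only through its entry \<open>i\<close>, so
  each term of the Leibniz expansion is a product of functions of separate entries.\<close>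

lemma has_sum_det_rows:
  fixes f :: "nat \<Rightarrow> nat \<Rightarrow> 'a \<Rightarrow> real"
  assumes "\<And>i j x. i < n \<Longrightarrow> j < n \<Longrightarrow> x \<in> B i \<Longrightarrow> f i j x \<ge> 0"
    and "\<And>i j. i < n \<Longrightarrow> j < n \<Longrightarrow> (f i j has_sum c i j) (B i)"
  shows "((\<lambda>xs. det (mat n n (\<lambda>(i, j). f i j (xs ! i)))) has_sum det (mat n n (\<lambda>(i, j). c i j))) (list_box n B)"
proof -
  have sums: "((\<lambda>xs. \<Sum>\<sigma>\<in>S. g \<sigma> xs) has_sum (\<Sum>\<sigma>\<in>S. s \<sigma>)) A"
    if "finite S" "\<And>\<sigma>. \<sigma> \<in> S \<Longrightarrow> (g \<sigma> has_sum s \<sigma>) A"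
    for S :: "(nat \<Rightarrow> nat) set" and g :: "_ \<Rightarrow> 'a list \<Rightarrow> real" and s A
    using that by (induction rule: finite_induct) (auto intro!: has_sum_add)
  show ?thesis
    unfolding det_mat_expand
  proof (intro sums has_sum_cmult_right has_sum_prod_list_box)
    show "finite {\<sigma>. \<sigma> permutes {0..<n}}" by (intro finite_permutations) auto
  qed (use assms in \<open>auto simp: permutes_in_image atLeast0LessThan\<close>)
qed

lemma has_sum_det_cols:
  fixes f :: "nat \<Rightarrow> nat \<Rightarrow> 'a \<Rightarrow> real"
  assumes "\<And>i j x. i < n \<Longrightarrow> j < n \<Longrightarrow> x \<in> B j \<Longrightarrow> f i j x \<ge> 0"
    and "\<And>i j. i < n \<Longrightarrow> j < n \<Longrightarrow> (f i j has_sum c i j) (B j)"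
  shows "((\<lambda>xs. det (mat n n (\<lambda>(i, j). f i j (xs ! j)))) has_sum det (mat n n (\<lambda>(i, j). c i j))) (list_box n B)"
  using has_sum_det_rows[of n B "\<lambda>i j. f j i" "\<lambda>i j. c j i"] assms
  unfolding det_mat_transpose[of n c] det_mat_transpose[of n "\<lambda>i j. f i j (_ ! j)"] by blast

lemma det_scale_rows:
  "det (mat n n (\<lambda>(i, j). c i * f i j)) = (\<Prod>i<n. c i) * (det (mat n n (\<lambda>(i, j). f i j)) :: real)"
  unfolding det_mat_expand sum_distrib_left prod.distrib by (simp add: mult_ac)

lemma det_scale_cols:
  "det (mat n n (\<lambda>(i, j). c j * f i j)) = (\<Prod>j<n. c j) * (det (mat n n (\<lambda>(i, j). f i j)) :: real)"
  using det_scale_rows[of n c "\<lambda>i j. f j i"]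
  unfolding det_mat_transpose[of n f] det_mat_transpose[of n "\<lambda>i j. c j * f i j"] .

text \<open>All column subtractions together are right multiplication by a unipotent upper
  triangular matrix.\<close>

lemma det_diff_prev_cols:
  fixes f :: "nat \<Rightarrow> nat \<Rightarrow> real"
  shows "det (mat n n (\<lambda>(i, j). f i j - (if j = 0 then 0 else f i (j - 1)))) = det (mat n n (\<lambda>(i, j). f i j))"
proof -
  define U where "U = mat n n (\<lambda>(i, j). if i = j then 1 else if Suc i = j then - 1 else 0 :: real)"
  have "det U = prod_list (diag_mat U)"
    by (rule det_upper_triangular[of _ n]) (auto simp: U_def upper_triangular_def)
  also have "\<dots> = 1"
    unfolding prod_list_diag_prod by (simp add: U_def)
  finally have U: "det U = 1" .
  have "mat n n (\<lambda>(i, j). f i j - (if j = 0 then 0 else f i (j - 1))) = mat n n (\<lambda>(i, j). f i j) * U"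
  proof (rule eq_matI)
    fix i j assume "i < dim_row (mat n n (\<lambda>(i, j). f i j) * U)" "j < dim_col (mat n n (\<lambda>(i, j). f i j) * U)"
    hence ij: "i < n" "j < n" by (auto simp: U_def)
    have "(mat n n (\<lambda>(i, j). f i j) * U) $$ (i, j) =
       (\<Sum>k\<in>{0..<n}. f i k * (if k = j then 1 else if Suc k = j then - 1 else 0))"
      using ij by (simp add: U_def scalar_prod_def)
    also have "\<dots> = (\<Sum>k\<in>{0..<n}. (if k = j then f i k else 0) - (if Suc k = j then f i k else 0))"
      by (rule sum.cong) auto
    also have "\<dots> = f i j - (\<Sum>k\<in>{0..<n}. if Suc k = j then f i k else 0)"
      using ij by (simp add: sum_subtractf)
    also have "(\<Sum>k\<in>{0..<n}. if Suc k = j then f i k else 0) = (if j = 0 then 0 else f i (j - 1))"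
      using ij by (cases j) auto
    finally show "mat n n (\<lambda>(i, j). f i j - (if j = 0 then 0 else f i (j - 1))) $$ (i, j) =
        (mat n n (\<lambda>(i, j). f i j) * U) $$ (i, j)"
      using ij by simp
  qed (auto simp: U_def)
  then show ?thesis
    using U by (subst (asm) arg_cong[of _ _ det]) (auto simp: det_mult[of _ n] U_def)
qed

lemma det_diff_next_cols:
  fixes f :: "nat \<Rightarrow> nat \<Rightarrow> real"
  shows "det (mat n n (\<lambda>(i, j). f i j - (if Suc j < n then f i (Suc j) else 0))) = det (mat n n (\<lambda>(i, j). f i j))"
proof -
  define U where "U = mat n n (\<lambda>(i, j). if i = j then 1 else if i = Suc j then - 1 else 0 :: real)"
  have "det U = prod_list (diag_mat U)"
    by (rule det_lower_triangular[of n]) (auto simp: U_def)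
  also have "\<dots> = 1"
    unfolding prod_list_diag_prod by (simp add: U_def)
  finally have U: "det U = 1" .
  have "mat n n (\<lambda>(i, j). f i j - (if Suc j < n then f i (Suc j) else 0)) = mat n n (\<lambda>(i, j). f i j) * U"
  proof (rule eq_matI)
    fix i j assume "i < dim_row (mat n n (\<lambda>(i, j). f i j) * U)" "j < dim_col (mat n n (\<lambda>(i, j). f i j) * U)"
    hence ij: "i < n" "j < n" by (auto simp: U_def)
    have "(mat n n (\<lambda>(i, j). f i j) * U) $$ (i, j) =
       (\<Sum>k\<in>{0..<n}. f i k * (if k = j then 1 else if k = Suc j then - 1 else 0))"
      using ij by (simp add: U_def scalar_prod_def)
    also have "\<dots> = (\<Sum>k\<in>{0..<n}. (if k = j then f i k else 0) - (if k = Suc j then f i k else 0))"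
      by (rule sum.cong) auto
    also have "\<dots> = f i j - (if Suc j < n then f i (Suc j) else 0)"
      using ij by (simp add: sum_subtractf)
    finally show "mat n n (\<lambda>(i, j). f i j - (if Suc j < n then f i (Suc j) else 0)) $$ (i, j) =
        (mat n n (\<lambda>(i, j). f i j) * U) $$ (i, j)"
      using ij by simp
  qed (auto simp: U_def)
  then show ?thesis
    using U by (subst (asm) arg_cong[of _ _ det]) (auto simp: det_mult[of _ n] U_def)
qed

text \<open>Undoing the column differences leaves \<open>f\<close> bordered by a column of ones. Row
  differences turn that column into the last unit vector, and expanding along it leaves the row
  differences of \<open>f\<close>.\<close>

lemma det_bordered_differences:
  fixes f :: "nat \<Rightarrow> nat \<Rightarrow> real"
  shows "det (mat (n + 1) (n + 1) (\<lambda>(i, j). (if j < n then f i j else 1) - (if j = 0 then 0 else f i (j - 1))))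
       = det (mat n n (\<lambda>(i, j). f i j - f (Suc i) j))"
proof -
  define g where "g i j = (if j < n then f i j else 1)" for i j
  \<comment> \<open>The last row is not differenced, so it keeps the only nonzero entry of the last
    column.\<close>
  define A where "A = mat (n + 1) (n + 1) (\<lambda>(i, j). g i j - (if Suc i < n + 1 then g (Suc i) j else 0))"
  have "mat (n + 1) (n + 1) (\<lambda>(i, j). (if j < n then f i j else 1) - (if j = 0 then 0 else f i (j - 1)))
     = mat (n + 1) (n + 1) (\<lambda>(i, j). g i j - (if j = 0 then 0 else g i (j - 1)))"
    by (rule eq_matI) (auto simp: g_def)
  hence "det (mat (n + 1) (n + 1) (\<lambda>(i, j). (if j < n then f i j else 1) - (if j = 0 then 0 else f i (j - 1))))
     = det (mat (n + 1) (n + 1) (\<lambda>(i, j). g i j))"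
    using det_diff_prev_cols[of "n + 1" g] by simp
  also have "\<dots> = det A"
    using det_diff_next_cols[of "n + 1" "\<lambda>i j. g j i"]
    unfolding A_def det_mat_transpose[of "n + 1" g]
      det_mat_transpose[of "n + 1" "\<lambda>i j. g i j - (if Suc i < n + 1 then g (Suc i) j else 0)"] by simp
  also have "det A = (\<Sum>i<n + 1. A $$ (i, n) * cofactor A i n)"
    by (rule laplace_expansion_column) (auto simp: A_def)
  also have "\<dots> = cofactor A n n"
    by (simp add: A_def g_def)
  also have "\<dots> = det (mat_delete A n n)"
    by (simp add: cofactor_def)
  also have "mat_delete A n n = mat n n (\<lambda>(i, j). f i j - f (Suc i) j)"
    by (rule eq_matI) (auto simp: mat_delete_def A_def g_def)
  finally show ?thesis .
qed

section \<open>Intertwining of the Karlin--McGregor kernels\<close>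

lemma Wch_iff_nth:
  "xs \<in> Wch I n \<longleftrightarrow> length xs = n \<and> (\<forall>j<n. xs ! j \<in> I) \<and> (\<forall>j. Suc j < n \<longrightarrow> xs ! j < xs ! Suc j)"
  unfolding Wch_def sorted_wrt_iff_nth_Suc_transp[OF transp_on_less]
  by (auto simp: set_conv_nth)

text \<open>Each entry of \<open>x\<close> ranges over an interval open below and closed above, with
  no lower bound for \<open>j = 0\<close> and no upper bound for \<open>j = n\<close>; the order of
  the entries is then automatic. The interval is written as a difference of nested lower sets, over
  which \<open>k\<close> has known sums.\<close>

lemma interl1_fibre_lower:
  assumes y: "y \<in> Wch I n"
  shows "{x \<in> Wch I (n + 1). interl1 x y}
    = list_box (n + 1) (\<lambda>j. {z \<in> I. j < n \<longrightarrow> z \<le> y ! j} - {z \<in> I. j > 0 \<and> z \<le> y ! (j - 1)})" (is "_ = ?R")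
proof (intro Set.set_eqI iffI)
  fix x assume "x \<in> {x \<in> Wch I (n + 1). interl1 x y}"
  hence x: "length x = n + 1" "\<And>j. j < n + 1 \<Longrightarrow> x ! j \<in> I"
    and i: "\<And>i. i < n \<Longrightarrow> x ! i \<le> y ! i \<and> y ! i < x ! (i + 1)"
    using y by (auto simp: Wch_iff_nth interl1_def)
  show "x \<in> ?R"
    unfolding list_box_def
  proof (intro CollectI conjI allI impI)
    fix j assume "j < n + 1"
    then show "x ! j \<in> {z \<in> I. j < n \<longrightarrow> z \<le> y ! j} - {z \<in> I. j > 0 \<and> z \<le> y ! (j - 1)}"
      using x(2)[of j] i[of j] i[of "j - 1"] by (cases j) auto
  qed (use x in auto)
next
  fix x assume "x \<in> ?R"
  hence l: "length x = n + 1" and x: "\<And>j. j < n + 1 \<Longrightarrow> x ! j \<in> I"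
    and u: "\<And>j. j < n \<Longrightarrow> x ! j \<le> y ! j" and d: "\<And>j. j < n \<Longrightarrow> y ! j < x ! (Suc j)"
    unfolding list_box_def by (fastforce simp: not_le)+
  have "x ! j < x ! Suc j" if "Suc j < n + 1" for j
    using u[of j] d[of j] that by simp
  then show "x \<in> {x \<in> Wch I (n + 1). interl1 x y}"
    using l x u d y by (auto simp: Wch_iff_nth interl1_def)
qed

text \<open>The intervals are now closed below and open above and are written with upper sets, over
  which the dual kernel has known sums.\<close>

lemma interl1_fibre_upper:
  "{y \<in> Wch I n. interl1 x y} = list_box n (\<lambda>i. {z \<in> I. x ! i \<le> z} - {z \<in> I. x ! (i + 1) \<le> z})" (is "_ = ?R")
proof (intro Set.set_eqI iffI)
  fix y assume "y \<in> {y \<in> Wch I n. interl1 x y}"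
  then show "y \<in> ?R" by (auto simp: Wch_iff_nth interl1_def list_box_def)
next
  fix y assume "y \<in> ?R"
  hence l: "length y = n" and y: "\<And>j. j < n \<Longrightarrow> y ! j \<in> I"
    and u: "\<And>j. j < n \<Longrightarrow> x ! j \<le> y ! j" and d: "\<And>j. j < n \<Longrightarrow> y ! j < x ! (Suc j)"
    by (auto simp: list_box_def not_le)
  have "y ! j < y ! Suc j" if "Suc j < n" for j
    using u[of "Suc j"] d[of j] that by simp
  then show "y \<in> {y \<in> Wch I n. interl1 x y}"
    using l y u d by (auto simp: Wch_iff_nth interl1_def)
qed

text \<open>Upper sets again, since this fibre is summed against the dual kernel; the last entry is
  unbounded above.\<close>

lemma interl0_fibre_lower:
  assumes y: "y \<in> Wch I n"
  shows "{x \<in> Wch I n. interl0 x y} = list_box n (\<lambda>j. {z \<in> I. y ! j \<le> z} - {z \<in> I. Suc j < n \<and> y ! Suc j \<le> z})" (is "_ = ?R")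
proof (intro Set.set_eqI iffI)
  fix x assume "x \<in> {x \<in> Wch I n. interl0 x y}"
  then show "x \<in> ?R" using y by (auto simp: Wch_iff_nth interl0_def list_box_def not_le)
next
  fix x assume "x \<in> ?R"
  hence l: "length x = n" and x: "\<And>j. j < n \<Longrightarrow> x ! j \<in> I"
    and u: "\<And>j. j < n \<Longrightarrow> y ! j \<le> x ! j" and d: "\<And>j. Suc j < n \<Longrightarrow> x ! j < y ! (Suc j)"
    by (auto simp: list_box_def not_le)
  have "x ! j < x ! Suc j" if "Suc j < n" for j
    using u[of "Suc j"] d[of j] that by simp
  then show "x \<in> {x \<in> Wch I n. interl0 x y}"
    using l x u d y by (auto simp: Wch_iff_nth interl0_def)
qed

text \<open>Lower sets, matching the sums of \<open>k\<close>; the first entry is unbounded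
  below.\<close>

lemma interl0_fibre_upper:
  "{y \<in> Wch I n. interl0 x y} = list_box n (\<lambda>i. {z \<in> I. z \<le> x ! i} - {z \<in> I. i > 0 \<and> z \<le> x ! (i - 1)})" (is "_ = ?R")
proof (intro Set.set_eqI iffI)
  fix y assume "y \<in> {y \<in> Wch I n. interl0 x y}"
  hence l: "length y = n" and y: "\<And>j. j < n \<Longrightarrow> y ! j \<in> I"
    and u: "\<And>j. j < n \<Longrightarrow> y ! j \<le> x ! j" and d: "\<And>j. Suc j < n \<Longrightarrow> x ! j < y ! (Suc j)"
    by (auto simp: Wch_iff_nth interl0_def)
  show "y \<in> ?R"
    unfolding list_box_def
  proof (intro CollectI conjI allI impI)
    fix j assume "j < n"
    then show "y ! j \<in> {z \<in> I. z \<le> x ! j} - {z \<in> I. j > 0 \<and> z \<le> x ! (j - 1)}"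
      using y[of j] u[of j] d[of "j - 1"] by auto
  qed (use l in auto)
next
  fix y assume "y \<in> ?R"
  hence l: "length y = n" and y: "\<And>j. j < n \<Longrightarrow> y ! j \<in> I"
    and u: "\<And>j. j < n \<Longrightarrow> y ! j \<le> x ! j" and d: "\<And>j. Suc j < n \<Longrightarrow> x ! j < y ! (Suc j)"
    unfolding list_box_def by (fastforce simp: not_le)+
  have "y ! j < y ! Suc j" if "Suc j < n" for j
    using u[of j] d[of j] that by simp
  then show "y \<in> {y \<in> Wch I n. interl0 x y}"
    using l y u d by (auto simp: Wch_iff_nth interl0_def)
qed

text \<open>What the determinant argument takes from the chains. Siegmund duality is encoded by the
  single function \<open>F\<close>, which gives both the lower sums of \<open>k\<close> and the
  upper sums of \<open>kh\<close>.\<close>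

locale dual_kernels =
  fixes I :: "int set" and k kh F :: "int \<Rightarrow> int \<Rightarrow> real" and w wh :: "int \<Rightarrow> real"
  assumes k_nonneg: "x \<in> I \<Longrightarrow> z \<in> I \<Longrightarrow> k x z \<ge> 0" and kh_nonneg: "x \<in> I \<Longrightarrow> z \<in> I \<Longrightarrow> kh x z \<ge> 0"
    and k_mass: "x \<in> I \<Longrightarrow> (k x has_sum 1) I"
    and k_lower: "x \<in> I \<Longrightarrow> y \<in> I \<Longrightarrow> (k x has_sum F x y) {z \<in> I. z \<le> y}"
    and kh_upper: "x \<in> I \<Longrightarrow> y \<in> I \<Longrightarrow> (kh y has_sum F x y) {z \<in> I. x \<le> z}"
    and w_nonneg: "x \<in> I \<Longrightarrow> w x \<ge> 0" and wh_nonneg: "x \<in> I \<Longrightarrow> wh x \<ge> 0"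
    and k_rev: "x \<in> I \<Longrightarrow> z \<in> I \<Longrightarrow> w x * k x z = w z * k z x"
    and kh_rev: "x \<in> I \<Longrightarrow> z \<in> I \<Longrightarrow> wh x * kh x z = wh z * kh z x"
begin

lemma intertwine_up:
  assumes x: "x \<in> Wch I (n + 1)" and y: "y \<in> Wch I n"
  shows "\<exists>c. ((\<lambda>x'. KM (n + 1) k x x' * ((\<Prod>i<n. wh (y ! i)) * (if interl1 x' y then 1 else 0)))
        has_sum c) (Wch I (n + 1))
    \<and> ((\<lambda>y'. (\<Prod>i<n. wh (y' ! i)) * KM n kh y' y) has_sum c) {y' \<in> Wch I n. interl1 x y'}"
proof (intro exI conjI)
  let ?f = "\<lambda>i j. F (x ! i) (y ! j)"
  \<comment> \<open>The common value: increments of \<open>F\<close> in the starting point, with the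
    weights of the fixed end point \<open>y\<close>.\<close>
  let ?c = "(\<Prod>i<n. wh (y ! i)) * det (mat n n (\<lambda>(i, j). ?f i j - ?f (Suc i) j))"
  have xI: "x ! i \<in> I" if "i < n + 1" for i using x that by (auto simp: Wch_iff_nth)
  have yI: "y ! i \<in> I" if "i < n" for i using y that by (auto simp: Wch_iff_nth)
  have x_step: "x ! i < x ! Suc i" if "i < n" for i using x that by (auto simp: Wch_iff_nth)
  have y_step: "y ! (i - 1) < y ! i" if "i < n" "i > 0" for i
    using y that by (cases i) (auto simp: Wch_iff_nth)
  have "((\<lambda>x'. det (mat (n + 1) (n + 1) (\<lambda>(i, j). k (x ! i) (x' ! j)))) has_sum
     det (mat (n + 1) (n + 1) (\<lambda>(i, j). (if j < n then ?f i j else 1) - (if j = 0 then 0 else ?f i (j - 1)))))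
     {x' \<in> Wch I (n + 1). interl1 x' y}"
    unfolding interl1_fibre_lower[OF y]
  proof (rule has_sum_det_cols)
    fix i j assume ij: "i < n + 1" "j < n + 1"
    \<comment> \<open>The last column has no upper constraint and sums to the total mass 1; it
      becomes the column of ones in \<open>det_bordered_differences\<close>.\<close>
    have "(k (x ! i) has_sum (if j < n then ?f i j else 1)) {z \<in> I. j < n \<longrightarrow> z \<le> y ! j}"
      using k_mass[OF xI[OF ij(1)]] k_lower[OF xI[OF ij(1)] yI[of j]] by (cases "j < n") auto
    moreover have "(k (x ! i) has_sum (if j = 0 then 0 else ?f i (j - 1))) {z \<in> I. j > 0 \<and> z \<le> y ! (j - 1)}"
      using k_lower[OF xI[OF ij(1)] yI[of "j - 1"]] ij by (cases "j = 0") auto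
    ultimately show "(k (x ! i) has_sum (if j < n then ?f i j else 1) - (if j = 0 then 0 else ?f i (j - 1)))
       ({z \<in> I. j < n \<longrightarrow> z \<le> y ! j} - {z \<in> I. j > 0 \<and> z \<le> y ! (j - 1)})"
      by (rule has_sum_Diff_subset) (use y_step[of j] in auto)
  qed (auto intro!: k_nonneg xI)
  hence "((\<lambda>x'. KM (n + 1) k x x' * (\<Prod>i<n. wh (y ! i))) has_sum ?c) {x' \<in> Wch I (n + 1). interl1 x' y}"
    unfolding KM_def det_bordered_differences[of n ?f] mult.commute[of _ "\<Prod>i<n. wh (y ! i)"] by (rule has_sum_cmult_right)
  also have "?this \<longleftrightarrow> ((\<lambda>x'. KM (n + 1) k x x' * ((\<Prod>i<n. wh (y ! i)) * (if interl1 x' y then 1 else 0)))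
        has_sum ?c) (Wch I (n + 1))"
    by (rule has_sum_cong_neutral) auto
  finally show "((\<lambda>x'. KM (n + 1) k x x' * ((\<Prod>i<n. wh (y ! i)) * (if interl1 x' y then 1 else 0)))
        has_sum ?c) (Wch I (n + 1))" .
  \<comment> \<open>The weights at the summation variables enter as row factors;
    \<open>kh_rev\<close> exchanges them for column factors at the fixed \<open>y\<close>.\<close>
  have "((\<lambda>y'. det (mat n n (\<lambda>(i, j). wh (y' ! i) * kh (y' ! i) (y ! j)))) has_sum
     det (mat n n (\<lambda>(i, j). wh (y ! j) * (?f i j - ?f (Suc i) j)))) {y' \<in> Wch I n. interl1 x y'}"
    unfolding interl1_fibre_upper
  proof (rule has_sum_det_rows[of n _ "\<lambda>i j z. wh z * kh z (y ! j)"])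
    fix i j assume ij: "i < n" "j < n"
    have "(kh (y ! j) has_sum (?f i j - ?f (Suc i) j)) ({z \<in> I. x ! i \<le> z} - {z \<in> I. x ! (i + 1) \<le> z})"
      using ij x_step[of i] by (intro has_sum_Diff_subset) (auto intro!: kh_upper xI yI)
    hence "((\<lambda>z. wh (y ! j) * kh (y ! j) z) has_sum wh (y ! j) * (?f i j - ?f (Suc i) j))
        ({z \<in> I. x ! i \<le> z} - {z \<in> I. x ! (i + 1) \<le> z})"
      by (rule has_sum_cmult_right)
    also have "?this \<longleftrightarrow> ((\<lambda>z. wh z * kh z (y ! j)) has_sum wh (y ! j) * (?f i j - ?f (Suc i) j))
        ({z \<in> I. x ! i \<le> z} - {z \<in> I. x ! (i + 1) \<le> z})"
      by (rule has_sum_cong) (use kh_rev yI ij in auto)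
    finally show "((\<lambda>z. wh z * kh z (y ! j)) has_sum wh (y ! j) * (?f i j - ?f (Suc i) j))
        ({z \<in> I. x ! i \<le> z} - {z \<in> I. x ! (i + 1) \<le> z})" .
  qed (auto intro!: mult_nonneg_nonneg kh_nonneg wh_nonneg yI)
  then show "((\<lambda>y'. (\<Prod>i<n. wh (y' ! i)) * KM n kh y' y) has_sum ?c) {y' \<in> Wch I n. interl1 x y'}"
    unfolding det_scale_rows det_scale_cols KM_def .
qed

text \<open>Both sums reduce to the square matrix of values of \<open>F\<close>: one yields its
  column differences, the other its row differences, and neither operation changes the
  determinant.\<close>

lemma intertwine_same:
  assumes x: "x \<in> Wch I n" and y: "y \<in> Wch I n"
  shows "\<exists>c. ((\<lambda>x'. KM n kh x x' * ((\<Prod>i<n. w (y ! i)) * (if interl0 x' y then 1 else 0)))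
        has_sum c) (Wch I n)
    \<and> ((\<lambda>y'. (\<Prod>i<n. w (y' ! i)) * KM n k y' y) has_sum c) {y' \<in> Wch I n. interl0 x y'}"
proof (intro exI conjI)
  \<comment> \<open>The arguments of \<open>F\<close> are exchanged, since now the dual kernel
    starts from \<open>x\<close>.\<close>
  let ?f = "\<lambda>i j. F (y ! j) (x ! i)"
  let ?c = "(\<Prod>i<n. w (y ! i)) * det (mat n n (\<lambda>(i, j). ?f i j))"
  have xI: "x ! i \<in> I" if "i < n" for i using x that by (auto simp: Wch_iff_nth)
  have yI: "y ! i \<in> I" if "i < n" for i using y that by (auto simp: Wch_iff_nth)
  have y_step: "y ! i < y ! Suc i" if "Suc i < n" for i using y that by (auto simp: Wch_iff_nth)
  have x_step: "x ! (i - 1) < x ! i" if "i < n" "i > 0" for i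
    using x that by (cases i) (auto simp: Wch_iff_nth)
  have "((\<lambda>x'. det (mat n n (\<lambda>(i, j). kh (x ! i) (x' ! j)))) has_sum
     det (mat n n (\<lambda>(i, j). ?f i j - (if Suc j < n then ?f i (Suc j) else 0)))) {x' \<in> Wch I n. interl0 x' y}"
    unfolding interl0_fibre_lower[OF y]
  proof (rule has_sum_det_cols)
    fix i j assume ij: "i < n" "j < n"
    have "(kh (x ! i) has_sum (if Suc j < n then ?f i (Suc j) else 0)) {z \<in> I. Suc j < n \<and> y ! Suc j \<le> z}"
      using kh_upper[OF yI xI[OF ij(1)], of "Suc j"] by (cases "Suc j < n") auto
    with kh_upper[OF yI[OF ij(2)] xI[OF ij(1)]]
    show "(kh (x ! i) has_sum ?f i j - (if Suc j < n then ?f i (Suc j) else 0))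
       ({z \<in> I. y ! j \<le> z} - {z \<in> I. Suc j < n \<and> y ! Suc j \<le> z})"
      by (rule has_sum_Diff_subset) (use y_step[of j] in auto)
  qed (auto intro!: kh_nonneg xI)
  hence "((\<lambda>x'. KM n kh x x' * (\<Prod>i<n. w (y ! i))) has_sum ?c) {x' \<in> Wch I n. interl0 x' y}"
    unfolding KM_def det_diff_next_cols[of n ?f] mult.commute[of _ "\<Prod>i<n. w (y ! i)"] by (rule has_sum_cmult_right)
  also have "?this \<longleftrightarrow> ((\<lambda>x'. KM n kh x x' * ((\<Prod>i<n. w (y ! i)) * (if interl0 x' y then 1 else 0)))
        has_sum ?c) (Wch I n)"
    by (rule has_sum_cong_neutral) auto
  finally show "((\<lambda>x'. KM n kh x x' * ((\<Prod>i<n. w (y ! i)) * (if interl0 x' y then 1 else 0)))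
        has_sum ?c) (Wch I n)" .
  have rows: "det (mat n n (\<lambda>(i, j). ?f i j - (if i = 0 then 0 else ?f (i - 1) j))) = det (mat n n (\<lambda>(i, j). ?f i j))"
    using det_diff_prev_cols[of n "\<lambda>i j. ?f j i"]
    unfolding det_mat_transpose[of n ?f] det_mat_transpose[of n "\<lambda>i j. ?f i j - (if i = 0 then 0 else ?f (i - 1) j)"] .
  have "((\<lambda>y'. det (mat n n (\<lambda>(i, j). w (y' ! i) * k (y' ! i) (y ! j)))) has_sum
     det (mat n n (\<lambda>(i, j). w (y ! j) * (?f i j - (if i = 0 then 0 else ?f (i - 1) j))))) {y' \<in> Wch I n. interl0 x y'}"
    unfolding interl0_fibre_upper
  proof (rule has_sum_det_rows[of n _ "\<lambda>i j z. w z * k z (y ! j)"])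
    fix i j assume ij: "i < n" "j < n"
    let ?B = "{z \<in> I. z \<le> x ! i} - {z \<in> I. i > 0 \<and> z \<le> x ! (i - 1)}"
    have "(k (y ! j) has_sum (if i = 0 then 0 else ?f (i - 1) j)) {z \<in> I. i > 0 \<and> z \<le> x ! (i - 1)}"
      using k_lower[OF yI[OF ij(2)] xI[of "i - 1"]] ij by (cases "i = 0") auto
    with k_lower[OF yI[OF ij(2)] xI[OF ij(1)]]
    have "(k (y ! j) has_sum (?f i j - (if i = 0 then 0 else ?f (i - 1) j))) ?B"
      by (rule has_sum_Diff_subset) (use x_step[of i] ij in auto)
    hence "((\<lambda>z. w (y ! j) * k (y ! j) z) has_sum w (y ! j) * (?f i j - (if i = 0 then 0 else ?f (i - 1) j))) ?B"
      by (rule has_sum_cmult_right)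
    also have "?this \<longleftrightarrow> ((\<lambda>z. w z * k z (y ! j)) has_sum w (y ! j) * (?f i j - (if i = 0 then 0 else ?f (i - 1) j))) ?B"
      by (rule has_sum_cong) (use k_rev yI ij in auto)
    finally show "((\<lambda>z. w z * k z (y ! j)) has_sum w (y ! j) * (?f i j - (if i = 0 then 0 else ?f (i - 1) j))) ?B" .
  qed (auto intro!: mult_nonneg_nonneg k_nonneg w_nonneg yI)
  then show "((\<lambda>y'. (\<Prod>i<n. w (y' ! i)) * KM n k y' y) has_sum ?c) {y' \<in> Wch I n. interl0 x y'}"
    unfolding det_scale_rows det_scale_cols rows KM_def .
qed

end

section \<open>Natural boundaries\<close>

lemma bd_pi_nonpos: "x \<le> 0 \<Longrightarrow> bd_pi lam mu x = (\<Prod>j\<in>{x + 1..0}. mu j / lam (j - 1))"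
  by (cases "x = 0")
     (auto simp: bd_pi_def intro!: prod.reindex_bij_witness[where j = "\<lambda>i. x + i" and i = "\<lambda>j. j - x"])

lemma bd_pi_step:
  assumes "lam x \<noteq> 0" "mu (x + 1) \<noteq> 0"
  shows "bd_pi lam mu x * lam x = bd_pi lam mu (x + 1) * mu (x + 1)"
proof (cases "x \<ge> 0")
  case True
  have "{1..x + 1} = insert (x + 1) {1..x}" using True by auto
  then show ?thesis using True assms by (simp add: bd_pi_def)
next
  case False
  have "{x + 1..0} = insert (x + 1) {x + 1 + 1..0}" using False by auto
  then show ?thesis using False assms by (simp add: bd_pi_nonpos)
qed

text \<open>Identifies this weight as the reversing measure of the dual chain, so that facts about
  \<open>bd_pi\<close> serve both chains.\<close>

lemma bd_pihat_eq_bd_pi: "bd_pihat lam mu = bd_pi (\<lambda>x. mu (x + 1)) lam"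
  by (auto simp: bd_pihat_def bd_pi_def fun_eq_iff)

text \<open>Positivity is asked only of the rates occurring in the product, because
  \<open>mu 0\<close> may vanish.\<close>

lemma bd_pi_pos:
  assumes "\<And>i. i > 0 \<and> i \<le> x \<or> x < i \<and> i \<le> 0 \<Longrightarrow> lam (i - 1) > 0 \<and> mu i > 0"
  shows "bd_pi lam mu x > 0"
proof (cases "x \<ge> 0")
  case True
  then show ?thesis unfolding bd_pi_def using assms by (auto intro!: prod_pos)
next
  case False
  then show ?thesis using assms by (auto simp: bd_pi_nonpos intro!: prod_pos)
qed

text \<open>Increment of the scale function times accumulated speed measure, as in Feller's test for
  an exit boundary at plus infinity.\<close>

abbreviation exit_term :: "(int \<Rightarrow> real) \<Rightarrow> (int \<Rightarrow> real) \<Rightarrow> int \<Rightarrow> real" where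
  "exit_term a p j \<equiv> 1 / (a j * p j) * (\<Sum>i\<in>{0..j}. p i)"

text \<open>Summation by parts: the flux bound makes \<open>u\<close> drop by at least
  \<open>c / (a i * p i)\<close> at each step, so the mass of \<open>p u\<close> dominates
  \<open>c\<close> times the partial sums of the series, up to starting them at \<open>M\<close>
  instead of 0.\<close>

lemma no_exitI:
  assumes p: "\<And>x. p x > 0" and a: "\<And>x. x \<ge> 0 \<Longrightarrow> a x > 0"
    and div: "\<And>K. \<exists>n::nat. (\<Sum>k<n. exit_term a p (int k)) > K"
  shows "no_exit a p"
  unfolding no_exit_def
proof (intro allI impI notI)
  fix u c m K
  assume c: "(c::real) > 0" and u: "\<forall>i. (u i :: real) \<ge> 0" and flux: "\<forall>i\<ge>m. a i * p i * (u i - u (i + 1)) \<ge> c"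
    and bd: "\<forall>l. (\<Sum>i\<in>{m..l}. p i * u i) \<le> K"
  \<comment> \<open>Positivity of \<open>a\<close> is known only from 0 on, so a negative
    \<open>m\<close> is moved up to 0.\<close>
  define M where "M = nat m"
  define S where "S j = (\<Sum>i\<in>{M..j}. p (int i))" for j
  define W where "W l = (\<Sum>j\<in>{M..l}. 1 / (a (int j) * p (int j)) * S j)" for l
  have p0: "p x \<ge> 0" for x by (rule less_imp_le[OF p])
  have m: "m \<le> int M" unfolding M_def by simp
  have S0: "S j \<ge> 0" for j unfolding S_def by (intro sum_nonneg p0)
  have u_step: "u (int i) \<ge> u (int (Suc i)) + c * (1 / (a (int i) * p (int i)))" if "i \<ge> M" for i
  proof -
    have "a (int i) * p (int i) > 0" using a p by simp
    moreover have "a (int i) * p (int i) * (u (int i) - u (int i + 1)) \<ge> c" using flux m that by auto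
    ultimately have "u (int i) - u (int i + 1) \<ge> c / (a (int i) * p (int i))"
      by (simp add: pos_divide_le_eq mult.commute)
    then show ?thesis by (simp add: add.commute)
  qed
  \<comment> \<open>The last term is nonnegative and is discarded afterwards; it is what carries the
    induction.\<close>
  have abel: "(\<Sum>i\<in>{M..l}. p (int i) * u (int i)) \<ge> c * W l + S l * u (int (Suc l))" if "l \<ge> M" for l
    using that
  proof (induction l rule: dec_induct)
    case base
    have "p (int M) * u (int M) \<ge> p (int M) * (u (int (Suc M)) + c * (1 / (a (int M) * p (int M))))"
      by (rule mult_left_mono[OF u_step[OF order_refl] less_imp_le[OF p]])
    then show ?case using p[of "int M"] by (simp add: W_def S_def algebra_simps)
  next
    case (step l)
    have "S (Suc l) * u (int (Suc l)) \<ge> S (Suc l) * (u (int (Suc (Suc l))) + c * (1 / (a (int (Suc l)) * p (int (Suc l)))))"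
      by (intro mult_left_mono u_step S0) (use step in simp)
    moreover have "S (Suc l) = S l + p (int (Suc l))"
      using step by (simp add: S_def)
    moreover have "W (Suc l) = W l + 1 / (a (int (Suc l)) * p (int (Suc l))) * S (Suc l)"
      using step by (simp add: W_def)
    moreover have "(\<Sum>i\<in>{M..Suc l}. p (int i) * u (int i)) = (\<Sum>i\<in>{M..l}. p (int i) * u (int i)) + p (int (Suc l)) * u (int (Suc l))"
      using step by simp
    ultimately show ?case using step.IH by (simp add: algebra_simps del: of_nat_Suc)
  qed
  have W: "W l \<le> K / c" if "l \<ge> M" for l
  proof -
    have "(\<Sum>i\<in>{M..l}. p (int i) * u (int i)) = (\<Sum>i\<in>{int M..int l}. p i * u i)"
      by (rule sum.reindex_bij_witness[where i = nat and j = int]) auto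
    also have "\<dots> \<le> (\<Sum>i\<in>{m..int l}. p i * u i)"
      using m u by (intro sum_mono2) (auto intro!: mult_nonneg_nonneg p0)
    also have "\<dots> \<le> K" using bd by blast
    finally have "c * W l \<le> K"
      using abel[OF that] S0[of l] u by (smt (verit) mult_nonneg_nonneg)
    then show ?thesis using c by (simp add: pos_le_divide_eq mult.commute)
  qed
  \<comment> \<open>As \<open>S j\<close> is at least \<open>p (int M)\<close>, the initial part of
    the inner sum is at most a fixed multiple of \<open>S j\<close>; the summand 1 accounts for
    \<open>S j\<close> itself.\<close>
  define C where "C = (\<Sum>i\<in>{0..int M}. p i) / p (int M) + 1"
  have C: "C > 0" unfolding C_def using p by (intro add_nonneg_pos divide_nonneg_pos sum_nonneg) (auto intro: p0)
  have cmp: "exit_term a p (int j) \<le> C * (1 / (a (int j) * p (int j)) * S j)" if j: "j \<ge> M" for j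
  proof -
    have "S j \<ge> p (int M)"
      unfolding S_def using j by (intro member_le_sum) (auto intro: p0)
    hence "(\<Sum>i\<in>{0..int M}. p i) \<le> (\<Sum>i\<in>{0..int M}. p i) / p (int M) * S j"
      using p[of "int M"] sum_nonneg[of "{0..int M}" p] less_imp_le[OF p]
      by (simp add: pos_le_divide_eq mult_left_mono)
    moreover have "(\<Sum>i\<in>{0..int j}. p i) \<le> (\<Sum>i\<in>{0..int M}. p i) + S j"
    proof -
      have "S j = (\<Sum>i\<in>{int M..int j}. p i)"
        unfolding S_def by (rule sum.reindex_bij_witness[where i = nat and j = int]) auto
      moreover have "(\<Sum>i\<in>{0..int j}. p i) \<le> (\<Sum>i\<in>{0..int M} \<union> {int M..int j}. p i)"
        by (intro sum_mono2) (auto intro: p0)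
      moreover have "\<dots> \<le> (\<Sum>i\<in>{0..int M}. p i) + (\<Sum>i\<in>{int M..int j}. p i)"
        by (subst sum_Un) (auto intro!: sum_nonneg p0)
      ultimately show ?thesis by simp
    qed
    ultimately have "(\<Sum>i\<in>{0..int j}. p i) \<le> C * S j"
      unfolding C_def by (simp add: algebra_simps)
    hence "1 / (a (int j) * p (int j)) * (\<Sum>i\<in>{0..int j}. p i) \<le> 1 / (a (int j) * p (int j)) * (C * S j)"
      using a[of "int j"] p[of "int j"] by (intro mult_left_mono) auto
    then show ?thesis by (simp add: mult.left_commute)
  qed
  have "(\<Sum>k<n. exit_term a p (int k)) \<le> (\<Sum>k<M. exit_term a p (int k)) + C * (K / c)" for n
  proof -
    have e0: "exit_term a p (int k) \<ge> 0" for k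
      using a[of "int k"] p0 by (intro mult_nonneg_nonneg sum_nonneg) (auto intro!: p0 divide_nonneg_nonneg mult_nonneg_nonneg)
    have "(\<Sum>k<n. exit_term a p (int k)) \<le> (\<Sum>k\<in>{..<M} \<union> {M..M + n}. exit_term a p (int k))"
      by (intro sum_mono2 e0) auto
    also have "\<dots> = (\<Sum>k<M. exit_term a p (int k)) + (\<Sum>k\<in>{M..M + n}. exit_term a p (int k))"
      by (intro sum.union_disjoint) auto
    also have "(\<Sum>k\<in>{M..M + n}. exit_term a p (int k)) \<le> (\<Sum>k\<in>{M..M + n}. C * (1 / (a (int k) * p (int k)) * S k))"
      by (intro sum_mono cmp) auto
    also have "\<dots> = C * W (M + n)"
      unfolding W_def sum_distrib_left ..
    also have "\<dots> \<le> C * (K / c)"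
      using C by (intro mult_left_mono W) auto
    finally show ?thesis by simp
  qed
  with div[of "(\<Sum>k<M. exit_term a p (int k)) + C * (K / c)"] show False
    by (meson not_less)
qed

lemma ennreal_suminf_infinite_imp_unbounded:
  fixes g :: "nat \<Rightarrow> real"
  assumes "(\<Sum>k. ennreal (g k)) = \<infinity>" and "\<And>k. g k \<ge> 0"
  shows "\<exists>n. (\<Sum>k<n. g k) > K"
proof (rule ccontr)
  assume "\<not> ?thesis"
  hence "(\<Sum>k<n. g k) \<le> K" for n by (auto simp: not_less)
  hence "(\<Sum>k<n. ennreal (g k)) \<le> ennreal K" for n
    using assms(2) by (simp add: sum_ennreal ennreal_leI)
  hence "(\<Sum>k. ennreal (g k)) \<le> ennreal K"
    by (intro suminf_le_const summableI)
  with assms(1) show False by (simp add: top_unique)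
qed

text \<open>Comparison with the boundary series, which on the integers leave out index 0;
  \<open>d\<close> absorbs the shift of the outer index.\<close>

lemma no_exit_of_series:
  assumes p: "\<And>x. p x > 0" and a: "\<And>x. x \<ge> 0 \<Longrightarrow> a x > 0"
    and inf: "(\<Sum>k::nat. ennreal (g k)) = \<infinity>" and g0: "\<And>k. g k \<ge> 0"
    and le: "\<And>k. g k \<le> exit_term a p (int (k + d))"
  shows "no_exit a p"
proof (rule no_exitI[OF p a])
  fix K
  have e0: "exit_term a p (int k) \<ge> 0" for k
    using a[of "int k"] p by (intro mult_nonneg_nonneg sum_nonneg) (auto intro!: less_imp_le)
  from ennreal_suminf_infinite_imp_unbounded[OF inf g0, of K]
  obtain n where "K < (\<Sum>k<n. g k)" by blast
  also have "\<dots> \<le> (\<Sum>k<n. exit_term a p (int (k + d)))"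
    by (intro sum_mono le)
  also have "\<dots> = (\<Sum>k\<in>{d..<n + d}. exit_term a p (int k))"
    using sum.shift_bounds_nat_ivl[of "\<lambda>k. exit_term a p (int k)" 0 d n] by (simp add: atLeast0LessThan)
  also have "\<dots> \<le> (\<Sum>k<n + d. exit_term a p (int k))"
    by (intro sum_mono2 e0) auto
  finally show "\<exists>n. K < (\<Sum>k<n. exit_term a p (int k))" by blast
qed auto

text \<open>Interchange of summation with \<open>s = j + i\<close>: it links the tail-sum form of
  the second boundary condition on \<open>{0..}\<close> to the partial sums used in
  \<open>no_exitI\<close>.\<close>

lemma double_series_le:
  fixes r p :: "nat \<Rightarrow> real"
  assumes r: "\<And>j. r j \<ge> 0" and p: "\<And>j. p j \<ge> 0" and bd: "\<And>n. (\<Sum>s<n. p s * (\<Sum>j\<le>s. r j)) \<le> K"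
  shows "(\<Sum>j. ennreal (r j) * (\<Sum>i. ennreal (p (j + i)))) \<le> ennreal K"
proof (rule suminf_le_const[OF summableI])
  fix n
  \<comment> \<open>The inner series could be infinite, so it is truncated first; the bound is
    uniform in \<open>m\<close>.\<close>
  have fin: "(\<Sum>j<n. ennreal (r j) * (\<Sum>i<m. ennreal (p (j + i)))) \<le> ennreal K" for m
  proof -
    have "(\<Sum>j<n. r j * (\<Sum>i<m. p (j + i))) = (\<Sum>(j, i)\<in>{..<n} \<times> {..<m}. r j * p (j + i))"
      by (simp add: sum_distrib_left sum.cartesian_product)
    \<comment> \<open>The rectangle of pairs is mapped injectively into the triangle
      \<open>j \<le> s < n + m\<close>.\<close>
    also have "\<dots> = (\<Sum>(s, j)\<in>(\<lambda>(j, i). (j + i, j)) ` ({..<n} \<times> {..<m}). p s * r j)"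
      by (subst sum.reindex) (auto simp: inj_on_def mult.commute intro!: sum.cong)
    also have "\<dots> \<le> (\<Sum>(s, j)\<in>Sigma {..<n + m} (\<lambda>s. {..s}). p s * r j)"
      by (rule sum_mono2) (auto intro!: mult_nonneg_nonneg r p)
    also have "\<dots> = (\<Sum>s<n + m. p s * (\<Sum>j\<le>s. r j))"
      by (simp add: sum.Sigma[symmetric] sum_distrib_left)
    also have "\<dots> \<le> K" by (rule bd)
    finally have "ennreal (\<Sum>j<n. r j * (\<Sum>i<m. p (j + i))) \<le> ennreal K"
      by (rule ennreal_leI)
    also have "ennreal (\<Sum>j<n. r j * (\<Sum>i<m. p (j + i))) = (\<Sum>j<n. ennreal (r j) * (\<Sum>i<m. ennreal (p (j + i))))"
      by (simp add: sum_ennreal ennreal_mult[symmetric] sum_nonneg r p)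
    finally show ?thesis .
  qed
  have "(\<lambda>m. \<Sum>j<n. ennreal (r j) * (\<Sum>i<m. ennreal (p (j + i))))
     \<longlonglongrightarrow> (\<Sum>j<n. ennreal (r j) * (\<Sum>i. ennreal (p (j + i))))"
    by (intro tendsto_sum ennreal_tendsto_cmult summable_LIMSEQ summableI) auto
  then show "(\<Sum>j<n. ennreal (r j) * (\<Sum>i. ennreal (p (j + i)))) \<le> ennreal K"
    by (rule LIMSEQ_le_const2) (use fin in auto)
qed

lemma siegmund_dual_pair_of_natural_boundaries:
  fixes I :: "int set" and lam mu :: "int \<Rightarrow> real"
  assumes I: "I = {0..} \<or> I = UNIV"
    and lam_pos: "\<forall>x\<in>I. lam x > 0"
    and mu_pos: "\<forall>x\<in>I. (I = UNIV \<or> x \<noteq> 0) \<longrightarrow> mu x > 0"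
    and nat_bd: "natural_boundaries I lam mu"
  shows "siegmund_dual_pair I (\<lambda>x. if x \<in> I then lam x else 0) (\<lambda>x. if x - 1 \<in> I then mu x else 0)
     (\<lambda>x. if x \<in> I then bd_pi lam mu x else 1) (\<lambda>x. if x \<in> I then bd_pihat lam mu x else 1)"
proof -
  let ?a = "\<lambda>x. if x \<in> I then lam x else 0" and ?b = "\<lambda>x. if x - 1 \<in> I then mu x else 0"
  let ?pi = "bd_pi lam mu" and ?ph = "bd_pihat lam mu"
  let ?p = "\<lambda>x. if x \<in> I then ?pi x else 1" and ?q = "\<lambda>x. if x \<in> I then ?ph x else 1"
  have up: "x + 1 \<in> I" if "x \<in> I" for x using I that by auto
  have nonneg_in: "x \<in> I" if "x \<ge> 0" for x using I that by auto
  have lam: "lam x > 0" if "x \<in> I" for x using lam_pos that by blast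
  have mu: "mu x > 0" if "x - 1 \<in> I" for x using I mu_pos that by auto
  have pos: "?pi x > 0" "?ph x > 0" if "x \<in> I" for x
    unfolding bd_pihat_eq_bd_pi using I that by (auto intro!: bd_pi_pos lam mu)
  have pi_step: "?pi x * lam x = ?pi (x + 1) * mu (x + 1)" if "x \<in> I" for x
    using lam[of x] mu[of "x + 1"] that by (intro bd_pi_step) auto
  have ph_step: "?ph x * mu (x + 1) = ?ph (x + 1) * lam (x + 1)" if "x \<in> I" for x
    unfolding bd_pihat_eq_bd_pi using lam[of "x + 1"] mu[of "x + 1"] up[of x] that by (intro bd_pi_step) auto
  have pp: "?p x > 0" "?q x > 0" for x using pos by auto
  \<comment> \<open>Up to the factor \<open>lam 0\<close> and an index shift, the reversing measure
    of each chain is the scale increment of the other. This turns the exit terms of the dual chain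
    into terms of the given series.\<close>
  have conj: "lam (int j) * ?pi (int j) * ?ph (int j) = lam 0" for j
  proof (induction j)
    case 0
    show ?case by (simp add: bd_pi_def bd_pihat_def)
  next
    case (Suc j)
    have j: "int j \<in> I" by (intro nonneg_in) simp
    have "mu (int j + 1) > 0" using mu[of "int j + 1"] j by simp
    moreover have "mu (int j + 1) * (lam (int j + 1) * ?pi (int j + 1) * ?ph (int j + 1))
       = (?pi (int j + 1) * mu (int j + 1)) * (?ph (int j + 1) * lam (int j + 1))" by simp
    hence "mu (int j + 1) * (lam (int j + 1) * ?pi (int j + 1) * ?ph (int j + 1)) = mu (int j + 1) * lam 0"
      unfolding pi_step[OF j, symmetric] ph_step[OF j, symmetric] Suc[symmetric] by (simp add: mult_ac)
    ultimately show ?case by (simp add: add.commute)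
  qed
  have inv_rate: "1 / (mu (int j + 1) * ?ph (int j)) = ?pi (int j + 1) / lam 0"
    and ph_eq: "?ph (int j) = lam 0 * (1 / (lam (int j) * ?pi (int j)))" for j
  proof -
    have j: "int j \<in> I" by (intro nonneg_in) simp
    have pos': "lam (int j) > 0" "?pi (int j) > 0" "?ph (int j) > 0" "mu (int j + 1) > 0" "lam 0 > 0"
      using lam pos mu[of "int j + 1"] j nonneg_in by auto
    from conj[of j] pos' show "?ph (int j) = lam 0 * (1 / (lam (int j) * ?pi (int j)))"
      by (simp add: field_simps)
    have "?pi (int j + 1) * (mu (int j + 1) * ?ph (int j)) = lam 0"
      unfolding conj[of j, symmetric] mult.assoc[symmetric] pi_step[OF j, symmetric] by (simp add: mult.commute)
    with pos' show "1 / (mu (int j + 1) * ?ph (int j)) = ?pi (int j + 1) / lam 0"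
      by (simp add: field_simps)
  qed
  have sum_p: "(\<Sum>i\<in>{0..int j}. ?p i) = (\<Sum>i\<in>{0..int j}. ?pi i)" for j
    by (rule sum.cong) (auto simp: nonneg_in)
  have hat_term: "exit_term (\<lambda>x. ?b (x + 1)) ?q (int j) = ?pi (int j + 1) * (\<Sum>i\<in>{0..int j}. 1 / (lam i * ?pi i))" for j
  proof -
    have sum_q: "(\<Sum>i\<in>{0..int j}. ?q i) = lam 0 * (\<Sum>i\<in>{0..int j}. 1 / (lam i * ?pi i))"
      unfolding sum_distrib_left
    proof (rule sum.cong)
      fix i assume "i \<in> {0..int j}"
      then show "?q i = lam 0 * (1 / (lam i * ?pi i))"
        using ph_eq[of "nat i"] nonneg_in[of i] by simp
    qed simp
    have "lam 0 > 0" by (intro lam nonneg_in) simp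
    then show ?thesis
      unfolding sum_q using inv_rate[of j] nonneg_in[of "int j"] by simp
  qed
  have a_pos: "?a x > 0" "?b (x + 1) > 0" if "x \<ge> 0" for x
    using nonneg_in[OF that] lam mu[of "x + 1"] by auto
  have recip: "1 / (lam i * ?pi i) > 0" if "i \<in> I" for i
    using lam[OF that] pos[OF that] by simp
  have "no_exit ?a ?p \<and> no_exit (\<lambda>x. ?b (- x)) (\<lambda>x. ?p (- x)) \<and> no_exit (\<lambda>x. ?b (x + 1)) ?q"
  proof (cases "I = {0..}")
    case True
    have nb: "(\<Sum>j::nat. ennreal (1 / (lam (int j) * ?pi (int j)) * (\<Sum>i\<in>{0..int j}. ?pi i))) = \<infinity>"
      "(\<Sum>j::nat. ennreal (1 / (lam (int j) * ?pi (int j))) * (\<Sum>i::nat. ennreal (?pi (int j + 1 + int i)))) = \<infinity>"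
      using nat_bd True by (auto simp: natural_boundaries_def Let_def)
    have "no_exit ?a ?p"
    proof (rule no_exit_of_series[OF pp(1) a_pos(1) nb(1), where d = 0])
      fix k
      show "1 / (lam (int k) * ?pi (int k)) * (\<Sum>i\<in>{0..int k}. ?pi i) \<ge> 0"
        using recip[of "int k"] pos nonneg_in by (intro mult_nonneg_nonneg sum_nonneg) (auto intro!: less_imp_le)
      show "1 / (lam (int k) * ?pi (int k)) * (\<Sum>i\<in>{0..int k}. ?pi i) \<le> exit_term ?a ?p (int (k + 0))"
        unfolding add_0_right sum_p using nonneg_in[of "int k"] by simp
    qed
    moreover have "no_exit (\<lambda>x. ?b (- x)) (\<lambda>x. ?p (- x))"
      unfolding no_exit_def
    proof (intro allI impI notI)
      fix u :: "int \<Rightarrow> real" and c m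
      assume "c > 0" "\<forall>i\<ge>m. ?b (- i) * ?p (- i) * (u i - u (i + 1)) \<ge> c"
      \<comment> \<open>On \<open>{0..}\<close> the downward rates are switched off at and below 0,
        so they carry no positive flux.\<close>
      from this(1) this(2)[rule_format, of "max m 0"] show False using True by auto
    qed
    moreover have "no_exit (\<lambda>x. ?b (x + 1)) ?q"
    proof (rule no_exitI[OF pp(2) a_pos(2)])
      fix K
      show "\<exists>n. (\<Sum>k<n. exit_term (\<lambda>x. ?b (x + 1)) ?q (int k)) > K"
      \<comment> \<open>Bounded partial sums of the exit terms would make the tail-sum series
        finite, against the second boundary condition.\<close>
      proof (rule ccontr)
        assume "\<not> ?thesis"
        hence bd: "(\<Sum>k<n. ?pi (int k + 1) * (\<Sum>i\<in>{0..int k}. 1 / (lam i * ?pi i))) \<le> K" for n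
          unfolding hat_term by (auto simp: not_less)
        have s: "(\<Sum>i\<in>{0..int k}. 1 / (lam i * ?pi i)) = (\<Sum>j\<le>k. 1 / (lam (int j) * ?pi (int j)))" for k
          by (rule sum.reindex_bij_witness[where i = int and j = nat]) auto
        have "(\<Sum>j. ennreal (1 / (lam (int j) * ?pi (int j))) * (\<Sum>i. ennreal (?pi (int (j + i) + 1)))) \<le> ennreal K"
          by (rule double_series_le[where p = "\<lambda>j. ?pi (int j + 1)"])
             (use bd recip pos nonneg_in in \<open>auto simp: s intro!: less_imp_le\<close>)
        moreover have sh: "int (j + i) + 1 = int j + 1 + int i" for i j :: nat by simp
        ultimately show False unfolding sh nb(2) by (simp add: top_unique)
      qed
    qed auto
    ultimately show ?thesis by blast
  next
    case False
    hence U: "I = UNIV" using I by auto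
    have nb: "(\<Sum>k::nat. ennreal (1 / (lam (int k + 1) * ?pi (int k + 1)) * (\<Sum>i\<in>{1..int k + 1}. ?pi i))) = \<infinity>"
      "(\<Sum>k::nat. ennreal (?pi (int k + 1) * (\<Sum>i\<in>{1..int k}. 1 / (lam i * ?pi i)))) = \<infinity>"
      "(\<Sum>k::nat. ennreal (1 / (lam (- int k - 1) * ?pi (- int k - 1)) * (\<Sum>i\<in>{- int k..-1}. ?pi i))) = \<infinity>"
      using nat_bd False by (auto simp: natural_boundaries_def Let_def)
    have "no_exit ?a ?p"
    proof (rule no_exit_of_series[OF pp(1) a_pos(1) nb(1), where d = 1])
      fix k
      show "1 / (lam (int k + 1) * ?pi (int k + 1)) * (\<Sum>i\<in>{1..int k + 1}. ?pi i) \<ge> 0"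
        using recip[of "int k + 1"] pos U by (intro mult_nonneg_nonneg sum_nonneg) (auto intro!: less_imp_le)
      have "(\<Sum>i\<in>{1..int k + 1}. ?pi i) \<le> (\<Sum>i\<in>{0..int k + 1}. ?pi i)"
        using pos U by (intro sum_mono2) (auto intro!: less_imp_le)
      hence "1 / (lam (int k + 1) * ?pi (int k + 1)) * (\<Sum>i\<in>{1..int k + 1}. ?pi i)
          \<le> 1 / (lam (int k + 1) * ?pi (int k + 1)) * (\<Sum>i\<in>{0..int k + 1}. ?pi i)"
        using recip[of "int k + 1"] U by (intro mult_left_mono) (auto intro!: less_imp_le)
      then show "1 / (lam (int k + 1) * ?pi (int k + 1)) * (\<Sum>i\<in>{1..int k + 1}. ?pi i) \<le> exit_term ?a ?p (int (k + 1))"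
        unfolding sum_p using U by (simp add: add.commute)
    qed
    moreover have "no_exit (\<lambda>x. ?b (- x)) (\<lambda>x. ?p (- x))"
    proof (rule no_exit_of_series[OF _ _ nb(3), where d = 0])
      fix k
      show "1 / (lam (- int k - 1) * ?pi (- int k - 1)) * (\<Sum>i\<in>{- int k..-1}. ?pi i) \<ge> 0"
        using recip[of "- int k - 1"] pos U by (intro mult_nonneg_nonneg sum_nonneg) (auto intro!: less_imp_le)
      have "(\<Sum>i\<in>{- int k..-1}. ?pi i) = (\<Sum>i\<in>{1..int k}. ?pi (- i))"
        by (rule sum.reindex_bij_witness[where i = uminus and j = uminus]) auto
      also have "\<dots> \<le> (\<Sum>i\<in>{0..int k}. ?pi (- i))"
        using pos U by (intro sum_mono2) (auto intro!: less_imp_le)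
      finally have "1 / (lam (- int k - 1) * ?pi (- int k - 1)) * (\<Sum>i\<in>{- int k..-1}. ?pi i)
          \<le> 1 / (lam (- int k - 1) * ?pi (- int k - 1)) * (\<Sum>i\<in>{0..int k}. ?pi (- i))"
        using recip[of "- int k - 1"] U by (intro mult_left_mono) (auto intro!: less_imp_le)
      \<comment> \<open>Detailed balance rewrites the edge weight with the downward rate, which is
        the upward rate of the reflected chain.\<close>
      also have "lam (- int k - 1) * ?pi (- int k - 1) = mu (- int k) * ?pi (- int k)"
        using pi_step[of "- int k - 1"] U by (simp add: mult.commute)
      finally show "1 / (lam (- int k - 1) * ?pi (- int k - 1)) * (\<Sum>i\<in>{- int k..-1}. ?pi i)
          \<le> exit_term (\<lambda>x. ?b (- x)) (\<lambda>x. ?p (- x)) (int (k + 0))"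
        using pi_step[of "- int k - 1"] U by (simp add: mult.commute)
    qed (use mu pp U in auto)
    moreover have "no_exit (\<lambda>x. ?b (x + 1)) ?q"
    proof (rule no_exit_of_series[OF pp(2) a_pos(2) nb(2), where d = 0])
      fix k
      show "?pi (int k + 1) * (\<Sum>i\<in>{1..int k}. 1 / (lam i * ?pi i)) \<ge> 0"
        using recip pos U by (intro mult_nonneg_nonneg sum_nonneg) (auto intro!: less_imp_le)
      have "(\<Sum>i\<in>{1..int k}. 1 / (lam i * ?pi i)) \<le> (\<Sum>i\<in>{0..int k}. 1 / (lam i * ?pi i))"
        using recip U by (intro sum_mono2) (auto intro!: less_imp_le)
      then show "?pi (int k + 1) * (\<Sum>i\<in>{1..int k}. 1 / (lam i * ?pi i)) \<le> exit_term (\<lambda>x. ?b (x + 1)) ?q (int (k + 0))"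
        unfolding add_0_right hat_term using pos[of "int k + 1"] U by (intro mult_left_mono) (auto intro!: less_imp_le)
    qed
    ultimately show ?thesis by blast
  qed
  then show ?thesis
    using up less_imp_le[OF lam] less_imp_le[OF mu] pp pi_step ph_step
    by unfold_locales (auto simp: nonneg_in)
qed

section \<open>From the dual pair of chains to the kernels of the theorem\<close>

lemma (in siegmund_dual_pair) dual_kernelsI:
  assumes t: "t \<ge> 0"
    and k: "\<And>x. x \<in> I \<Longrightarrow> k x = D.P t x" and kh: "\<And>x. x \<in> I \<Longrightarrow> kh x = H.P t x"
    and w: "\<And>x. x \<in> I \<Longrightarrow> w x = p x" and wh: "\<And>x. x \<in> I \<Longrightarrow> wh x = ph x"
  shows "dual_kernels I k kh (\<lambda>x y. infsum (D.P t x) {..y}) w wh"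
proof
  fix x y assume x: "x \<in> I"
  show "(k x has_sum 1) I"
    using has_sum_infsum[OF D.P_summable[OF t, of x UNIV]] D_outside[OF x]
    unfolding k[OF x] D_conservative[OF t]
    by (subst has_sum_cong_neutral[of UNIV I _ "D.P t x"]) auto
  show "(k x has_sum infsum (D.P t x) {..y}) {z \<in> I. z \<le> y}"
    using has_sum_infsum[OF D.P_summable[OF t, of x "{..y}"]] D_outside[OF x]
    unfolding k[OF x] by (subst has_sum_cong_neutral[of "{..y}" _ _ "D.P t x"]) auto
  assume y: "y \<in> I"
  have "{z \<in> I. x \<le> z} = {x..}" using I_up_le[OF x] by auto
  then show "(kh y has_sum infsum (D.P t x) {..y}) {z \<in> I. x \<le> z}"
    using has_sum_infsum[OF H.P_summable[OF t, of y "{x..}"]]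
    unfolding kh[OF y] siegmund_duality[OF t x] by simp
qed (use t k kh w wh D.P_nonneg H.P_nonneg D_reversible H_reversible less_imp_le[OF p_pos] less_imp_le[OF ph_pos] in auto)

theorem theorem1p1:
  fixes I :: "int set" and lam mu :: "int \<Rightarrow> real" and n :: nat and t :: real
  assumes I: "I = {0..} \<or> I = UNIV"
    and lam_pos: "\<forall>x\<in>I. lam x > 0"
    and mu_pos: "\<forall>x\<in>I. (I = UNIV \<or> x \<noteq> 0) \<longrightarrow> mu x > 0"
    and mu0: "I = {0..} \<longrightarrow> mu 0 = 0"
    and nat_bd: "natural_boundaries I lam mu"
    and n: "n \<ge> 1" and t: "t \<ge> 0"
  shows
   "(\<forall>x\<in>Wch I (n + 1). \<forall>y'\<in>Wch I n. \<exists>c.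
      ((\<lambda>x'. KM (n + 1) (bd_p I lam mu t) x x' *
              ((\<Prod>i<n. bd_pihat lam mu (y' ! i)) * (if interl1 x' y' then 1 else 0)))
        has_sum c) (Wch I (n + 1))
    \<and> ((\<lambda>y. (\<Prod>i<n. bd_pihat lam mu (y ! i)) * KM n (bd_phat I lam mu t) y y')
        has_sum c) {y\<in>Wch I n. interl1 x y})
  \<and> (\<forall>x\<in>Wch I n. \<forall>y'\<in>Wch I n. \<exists>c.
      ((\<lambda>x'. KM n (bd_phat I lam mu t) x x' *
              ((\<Prod>i<n. bd_pi lam mu (y' ! i)) * (if interl0 x' y' then 1 else 0)))
        has_sum c) (Wch I n)
    \<and> ((\<lambda>y. (\<Prod>i<n. bd_pi lam mu (y ! i)) * KM n (bd_p I lam mu t) y y')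
        has_sum c) {y\<in>Wch I n. interl0 x y})"
proof -
  interpret siegmund_dual_pair I "\<lambda>x. if x \<in> I then lam x else 0" "\<lambda>x. if x - 1 \<in> I then mu x else 0"
     "\<lambda>x. if x \<in> I then bd_pi lam mu x else 1" "\<lambda>x. if x \<in> I then bd_pihat lam mu x else 1"
    by (rule siegmund_dual_pair_of_natural_boundaries[OF I lam_pos mu_pos nat_bd])
  \<comment> \<open>The extended chain has no downward jump at a bottom state;
    \<open>mu 0 = 0\<close> makes its holding rate there agree with the one in
    \<open>mtp\<close>.\<close>
  have edge: "mu x = 0" if "x \<in> I" "x - 1 \<notin> I" for x
  proof -
    have "I = {0..}" using I that by auto
    moreover from this have "x = 0" using that by auto
    ultimately show ?thesis using mu0 by simp
  qed
  have "bd_p I lam mu t x = D.P t x" if "x \<in> I" for x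
    unfolding bd_p_def
    by (intro ext D.mtp_eq_P) (use that t edge I_up in auto)
  moreover have "bd_phat I lam mu t x = H.P t x" if "x \<in> I" for x
    unfolding bd_phat_def
    by (intro ext H.mtp_eq_P) (use that t I_up in auto)
  ultimately interpret dual_kernels I "bd_p I lam mu t" "bd_phat I lam mu t"
    "\<lambda>x y. infsum (D.P t x) {..y}" "bd_pi lam mu" "bd_pihat lam mu"
    by (intro dual_kernelsI t) auto
  show ?thesis
    using intertwine_up intertwine_same by blast
qed

end
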